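(* Let $m,n\geq 1$ and $L\geq 2$ be integers, let $d_0=n$, $d_L=m$ and $d_1,\dots,d_{L-1}\geq 1$, and let $W^{[l]}(t)\in\mathbb{R}^{d_{l+1}\times d_l}$, $l=0,\dots,L-1$, be factor matrices with end-to-end product $X(t)=W^{[L-1]}(t)W^{[L-2]}(t)\cdots W^{[0]}(t)\in\mathbb{R}^{m\times n}$. Assume the factors are balanced at initialization: $$\big[W^{[l+1]}(0)\big]^{\top}W^{[l+1]}(0)=W^{[l]}(0)\big[W^{[l]}(0)\big]^{\top},\qquad l=0,\dots,L-2 .$$ Let $\mathcal{L}_{\mathbb{Y}}:\mathbb{R}^{m\times n}\to\mathbb{R}$ be an analytic function, let $\lambda_r,\lambda_c\geq 0$, and let $L_r\in\mathbb{R}^{m\times m}$ and $L_c\in\mathbb{R}^{n\times n}$ be fixed Laplacian matrices obtained from the adaptive parameterization described in the context. Define $$\mathcal{L}(X)=\mathcal{L}_{\mathbb{Y}}(X)+\lambda_r\,\mathrm{tr}\big(X^{\top}L_rX\big)+\lambda_c\,\mathrm{tr}\big(XL_cX^{\top}\big),$$ and suppose the factors evolve by the gradient flow $$\dot W^{[l]}(t)=-\frac{\partial}{\partial W^{[l]}}\mathcal{L}(X(t)),\qquad t\geq 0,\quad l=0,\dots,L-1 .$$ Let $X(t)=U(t)S(t)V(t)^{\top}$ be an analytic singular value decomposition, let $\sigma_k(t)\geq 0$ be the $k$-th singular value (the $k$-th diagonal entry of $S(t)$), and let $u_k(t)$ and $v_k(t)$ be the corresponding left and right singular vectors (the $k$-th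 columns of $U(t)$ and $V(t)$), so that $X=\sum_s\sigma_s u_s v_s^{\top}$. Then for every $k=1,\dots,\min\{m,n\}$, $$\dot\sigma_k(t)=-L\big(\sigma_k^2(t)\big)^{1-\frac1L}\Big\langle \nabla_X\mathcal{L}_{\mathbb{Y}}(X(t)),\,u_k(t)v_k(t)^{\top}\Big\rangle-2L\big(\sigma_k^2(t)\big)^{\frac32-\frac1L}\gamma_k(t),$$ where $\gamma_k(t)=\lambda_r\,u_k(t)^{\top}L_ru_k(t)+\lambda_c\,v_k(t)^{\top}L_cv_k(t)\geq 0$ and $\langle\cdot,\cdot\rangle$ is the Frobenius inner product.
   Context: Adaptive Laplacian parameterization: for a size $p$ and a parameter matrix $W\in\mathbb{R}^{p\times p}$, set $A=\dfrac{\exp(W+W^{\top})}{\mathbf{1}_p^{\top}\exp(W)\mathbf{1}_p}$ (with $\exp$ applied entrywise and $\mathbf{1}_p$ the all-ones vector), which is symmetric with positive entries, and $L=\big(A\,\mathbf{1}_{p\times p}\big)\odot I_p-A$, i.e. $L=D-A$ with $D$ the diagonal degree matrix $D_{ii}=\sum_j A_{ij}$ ($\mathbf{1}_{p\times p}$ the all-ones matrix, $\odot$ the Hadamard product). $L_r$ is obtained this way with $p=m$ from a parameter $W_r\in\mathbb{R}^{m\times m}$, and $L_c$ with $p=n$ from a parameter $W_c\in\mathbb{R}^{n\times n}$; such Laplacians are symmetric positive semidefinite. The analytic SVD of $X(t)$ exists by analyticity of the loss (as in Arora et al.'s deep matrix factorization analysis). *)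

theory Defs
  imports "HOL-Analysis.Infinite_Sum" "HOL-Analysis.Derivative" "Jordan_Normal_Form.Matrix"
begin

text \<open>Matrices are Jordan_Normal_Form matrices (real mat), whose dimensions are part of
the value; this allows the layer widths d_l to vary with l.\<close>

definition analytic_on_nonneg :: "(real \<Rightarrow> real) \<Rightarrow> bool" where
  "analytic_on_nonneg f \<longleftrightarrow>
     (\<forall>t\<ge>0. \<exists>r>0. \<exists>c::nat \<Rightarrow> real.
        \<forall>s\<ge>0. \<bar>s - t\<bar> < r \<longrightarrow> (\<lambda>k. c k * (s - t) ^ k) sums f s)"

text \<open>Real-analytic function on the space of m x n real matrices: around every point it is
given by an (unconditionally, hence absolutely) convergent multivariate power series in the
m*n entries; multi-indices are functions alpha with alpha i j = 0 outside the index range.\<close>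
definition analytic_mat_fun :: "nat \<Rightarrow> nat \<Rightarrow> (real mat \<Rightarrow> real) \<Rightarrow> bool" where
  "analytic_mat_fun m n f \<longleftrightarrow>
     (\<forall>X \<in> carrier_mat m n. \<exists>r>0. \<exists>c::(nat \<Rightarrow> nat \<Rightarrow> nat) \<Rightarrow> real.
        \<forall>H \<in> carrier_mat m n. (\<forall>i<m. \<forall>j<n. \<bar>H $$ (i,j)\<bar> < r) \<longrightarrow>
          ((\<lambda>\<alpha>. c \<alpha> * (\<Prod>i<m. \<Prod>j<n. (H $$ (i,j)) ^ (\<alpha> i j))) has_sum f (X + H))
            {\<alpha>. \<forall>i j. (m \<le> i \<or> n \<le> j) \<longrightarrow> \<alpha> i j = 0})"

definition unit_entry_mat :: "nat \<Rightarrow> nat \<Rightarrow> nat \<Rightarrow> nat \<Rightarrow> real mat" where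
  "unit_entry_mat r c i j = mat r c (\<lambda>(a,b). if a = i \<and> b = j then 1 else 0)"

definition grad_mat :: "(real mat \<Rightarrow> real) \<Rightarrow> real mat \<Rightarrow> real mat" where
  "grad_mat f M = mat (dim_row M) (dim_col M)
     (\<lambda>(i,j). deriv (\<lambda>h. f (M + h \<cdot>\<^sub>m unit_entry_mat (dim_row M) (dim_col M) i j)) 0)"

definition frob_inner :: "real mat \<Rightarrow> real mat \<Rightarrow> real" where
  "frob_inner A B = (\<Sum>i<dim_row A. \<Sum>j<dim_col A. A $$ (i,j) * B $$ (i,j))"

definition outer_prod :: "real vec \<Rightarrow> real vec \<Rightarrow> real mat" where
  "outer_prod u v = mat (dim_vec u) (dim_vec v) (\<lambda>(i,j). u $ i * v $ j)"

fun prod_layers :: "(nat \<Rightarrow> real mat) \<Rightarrow> nat \<Rightarrow> nat \<Rightarrow> real mat" where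
  "prod_layers Ws n0 0 = 1\<^sub>m n0"
| "prod_layers Ws n0 (Suc k) = Ws k * prod_layers Ws n0 k"

definition adaptive_adj :: "nat \<Rightarrow> real mat \<Rightarrow> real mat" where
  "adaptive_adj p W = (1 / (\<Sum>i<p. \<Sum>j<p. exp (W $$ (i,j)))) \<cdot>\<^sub>m
       mat p p (\<lambda>(i,j). exp (W $$ (i,j) + W $$ (j,i)))"

definition adaptive_laplacian :: "nat \<Rightarrow> real mat \<Rightarrow> real mat" where
  "adaptive_laplacian p W =
     mat p p (\<lambda>(i,j). if i = j then (\<Sum>k<p. adaptive_adj p W $$ (i,k)) else 0) - adaptive_adj p W"

definition mat_trace :: "real mat \<Rightarrow> real" where
  "mat_trace A = (\<Sum>i<dim_row A. A $$ (i,i))"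

definition reg_loss :: "(real mat \<Rightarrow> real) \<Rightarrow> real \<Rightarrow> real \<Rightarrow> real mat \<Rightarrow> real mat \<Rightarrow> real mat \<Rightarrow> real" where
  "reg_loss LY lr lc Lr Lc X = LY X + lr * mat_trace (transpose_mat X * Lr * X)
                                 + lc * mat_trace (X * Lc * transpose_mat X)"

end

theory Submission
  imports Defs
begin

text \<open>
  Write \<open>X = R\<^sub>l Q\<^sub>l\<close> with \<open>Q\<^sub>l = W\<^sub>l\<^sub>-\<^sub>1 \<cdots> W\<^sub>0\<close> and \<open>R\<^sub>l = W\<^sub>L\<^sub>-\<^sub>1 \<cdots> W\<^sub>l\<close>, and let \<open>G\<close> be the gradient
  of the regularised loss at \<open>X\<close>. The flow reads \<open>W\<^sub>l' = - R\<^sub>l\<^sub>+\<^sub>1\<^sup>T G Q\<^sub>l\<^sup>T\<close>, so it conserves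
  \<open>W\<^sub>l\<^sub>+\<^sub>1\<^sup>T W\<^sub>l\<^sub>+\<^sub>1 - W\<^sub>l W\<^sub>l\<^sup>T\<close>, and the factors stay balanced. Balancedness gives
  \<open>R\<^sub>l R\<^sub>l\<^sup>T = A^(L-l)\<close> and \<open>Q\<^sub>l\<^sup>T Q\<^sub>l = B^l\<close> for the Gram matrices \<open>A = W\<^sub>L\<^sub>-\<^sub>1 W\<^sub>L\<^sub>-\<^sub>1\<^sup>T\<close> and
  \<open>B = W\<^sub>0\<^sup>T W\<^sub>0\<close>. Since \<open>A^L = X X\<^sup>T\<close> and \<open>B^L = X\<^sup>T X\<close>, the singular vectors \<open>u\<close> and \<open>v\<close> are
  eigenvectors of \<open>A\<close> and \<open>B\<close> with eigenvalue \<open>\<mu> = (\<sigma>\<^sup>2)^(1/L)\<close>. Each of the \<open>L\<close> terms of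
  \<open>X' = - (\<Sum>l. R\<^sub>l\<^sub>+\<^sub>1 R\<^sub>l\<^sub>+\<^sub>1\<^sup>T G Q\<^sub>l\<^sup>T Q\<^sub>l)\<close> therefore contributes \<open>- \<mu>^(L-1) (u \<bullet> G v)\<close> to
  \<open>u \<bullet> X' v\<close>, which is the derivative of \<open>\<sigma>\<close>.
\<close>

section \<open>Matrix products and the Frobenius inner product\<close>

lemma assoc_mult_mat_dim:
  fixes A B C :: "'a :: semiring_0 mat"
  assumes "dim_col A = dim_row B" and "dim_col B = dim_row C"
  shows "(A * B) * C = A * (B * C)"
  using assms by (intro assoc_mult_mat[of A _ "dim_col A" B "dim_col B" C]) auto

lemma assoc_mult_mat_vec_dim:
  fixes A B :: "'a :: semiring_0 mat"
  assumes "dim_col A = dim_row B" and "dim_col B = dim_vec v"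
  shows "(A * B) *\<^sub>v v = A *\<^sub>v (B *\<^sub>v v)"
  using assms by (intro assoc_mult_mat_vec[of A _ "dim_col A" B "dim_col B"]) auto

lemma transpose_mult_dim:
  fixes A B :: "'a :: comm_semiring_0 mat"
  assumes "dim_col A = dim_row B"
  shows "(A * B)\<^sup>T = B\<^sup>T * A\<^sup>T"
  using assms by (intro transpose_mult[of A _ "dim_col A" B]) auto

lemma smult_mult_mat_vec:
  fixes A :: "'a :: comm_semiring_0 mat"
  assumes "dim_col A = dim_vec v"
  shows "(a \<cdot>\<^sub>m A) *\<^sub>v v = a \<cdot>\<^sub>v (A *\<^sub>v v)"
  using assms by (intro eq_vecI) auto

lemma frob_inner_eq_trace:
  assumes "A \<in> carrier_mat r c" and "B \<in> carrier_mat r c"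
  shows "frob_inner A B = mat_trace (A\<^sup>T * B)"
  using assms unfolding frob_inner_def mat_trace_def
  by (subst sum.swap) (auto simp: scalar_prod_def lessThan_atLeast0 intro!: sum.cong)

lemma frob_inner_commute:
  assumes "A \<in> carrier_mat r c" and "B \<in> carrier_mat r c"
  shows "frob_inner A B = frob_inner B A"
  using assms by (simp add: frob_inner_def mult.commute)

lemma frob_inner_transpose:
  assumes "A \<in> carrier_mat r c" and "B \<in> carrier_mat r c"
  shows "frob_inner A\<^sup>T B\<^sup>T = frob_inner A B"
  using assms unfolding frob_inner_def by (subst sum.swap) (auto intro!: sum.cong)

lemma frob_inner_mult_left:
  assumes "G \<in> carrier_mat m n" and "R \<in> carrier_mat m p" and "H \<in> carrier_mat p n"
  shows "frob_inner G (R * H) = frob_inner (R\<^sup>T * G) H"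
  using assms
  by (subst (1 2) frob_inner_eq_trace) (auto simp: transpose_mult_dim assoc_mult_mat_dim)

lemma frob_inner_mult_right:
  assumes G: "G \<in> carrier_mat m n" and H: "H \<in> carrier_mat m q" and Q: "Q \<in> carrier_mat q n"
  shows "frob_inner G (H * Q) = frob_inner (G * Q\<^sup>T) H"
proof -
  have "frob_inner G (H * Q) = frob_inner G\<^sup>T (Q\<^sup>T * H\<^sup>T)"
    using assms frob_inner_transpose[of G m n "H * Q"] by (simp add: transpose_mult_dim)
  also have "\<dots> = frob_inner (G * Q\<^sup>T)\<^sup>T H\<^sup>T"
    using assms by (simp add: frob_inner_mult_left[of _ n m _ q] transpose_mult_dim)
  also have "\<dots> = frob_inner (G * Q\<^sup>T) H"
    using assms by (intro frob_inner_transpose) auto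
  finally show ?thesis .
qed

lemma frob_inner_add_left:
  assumes "A \<in> carrier_mat m n" and "B \<in> carrier_mat m n"
  shows "frob_inner (A + B) H = frob_inner A H + frob_inner B H"
  using assms by (simp add: frob_inner_def sum.distrib algebra_simps)

lemma frob_inner_smult_left: "frob_inner (c \<cdot>\<^sub>m A) H = c * frob_inner A H"
  by (simp add: frob_inner_def sum_distrib_left mult.assoc)

lemma frob_inner_outer_prod:
  assumes "G \<in> carrier_mat m n" and "u \<in> carrier_vec m" and "v \<in> carrier_vec n"
  shows "frob_inner G (outer_prod u v) = u \<bullet> (G *\<^sub>v v)"
  using assms unfolding frob_inner_def outer_prod_def
  by (auto intro!: sum.cong
      simp: scalar_prod_def lessThan_atLeast0 sum_distrib_left algebra_simps)

lemma frob_inner_add_smult: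
  assumes "A \<in> carrier_mat r c" "B \<in> carrier_mat r c" "C \<in> carrier_mat r c" "D \<in> carrier_mat r c"
  shows "frob_inner (A + h \<cdot>\<^sub>m B) (C + h \<cdot>\<^sub>m D)
    = frob_inner A C + h * (frob_inner A D + frob_inner B C) + h\<^sup>2 * frob_inner B D"
  using assms
  by (simp add: frob_inner_def sum_distrib_left sum.distrib[symmetric] power2_eq_square algebra_simps)

lemma mat_trace_quadratic_directional_derivative:
  assumes X: "X \<in> carrier_mat p q" and H: "H \<in> carrier_mat p q" and K: "K \<in> carrier_mat p p" "K\<^sup>T = K"
  shows "((\<lambda>h. mat_trace ((X + h \<cdot>\<^sub>m H)\<^sup>T * K * (X + h \<cdot>\<^sub>m H)))
    has_real_derivative 2 * frob_inner (K * X) H) (at 0)"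
proof -
  have KX: "K * X \<in> carrier_mat p q" and KH: "K * H \<in> carrier_mat p q" using X H K by auto
  have "mat_trace ((X + h \<cdot>\<^sub>m H)\<^sup>T * K * (X + h \<cdot>\<^sub>m H))
      = frob_inner X (K * X) + h * (2 * frob_inner (K * X) H) + h\<^sup>2 * frob_inner H (K * H)" for h
  proof -
    have "mat_trace ((X + h \<cdot>\<^sub>m H)\<^sup>T * K * (X + h \<cdot>\<^sub>m H)) = frob_inner (X + h \<cdot>\<^sub>m H) (K * (X + h \<cdot>\<^sub>m H))"
      using X H K by (subst frob_inner_eq_trace[of _ p q]) (auto simp: assoc_mult_mat_dim)
    also have "K * (X + h \<cdot>\<^sub>m H) = K * X + h \<cdot>\<^sub>m (K * H)"
      using X H K by (simp add: mult_add_distrib_mat[of K p p] mult_smult_distrib[of K p p])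
    also have "frob_inner (X + h \<cdot>\<^sub>m H) \<dots> = frob_inner X (K * X)
        + h * (frob_inner X (K * H) + frob_inner H (K * X)) + h\<^sup>2 * frob_inner H (K * H)"
      by (rule frob_inner_add_smult[OF X H KX KH])
    also have "frob_inner X (K * H) = frob_inner (K * X) H"
      using frob_inner_mult_left[OF X K(1) H] K(2) by simp
    also have "frob_inner H (K * X) = frob_inner (K * X) H"
      by (rule frob_inner_commute[OF H KX])
    finally show ?thesis by simp
  qed
  then show ?thesis by (auto intro!: derivative_eq_intros)
qed

section \<open>Power series and analytic functions\<close>

lemma islimpt_atLeast:
  fixes a t :: real
  assumes "a \<le> t"
  shows "t islimpt {a..}"
  unfolding islimpt_approachable
proof (intro allI impI)
  fix e :: real assume "e > 0"
  then show "\<exists>s\<in>{a..}. s \<noteq> t \<and> dist s t < e"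
    using assms by (intro bexI[of _ "t + e / 2"]) (auto simp: dist_real_def)
qed

lemma power_series_has_real_derivative:
  fixes f :: "real \<Rightarrow> real"
  assumes "t \<in> S" and "t islimpt S" and "r > 0"
    and sums: "\<And>s. s \<in> S \<Longrightarrow> \<bar>s - t\<bar> < r \<Longrightarrow> (\<lambda>k. a k * (s - t) ^ k) sums f s"
  shows "(f has_real_derivative a 1) (at t within S)"
proof -
  obtain s where s: "s \<in> S" "s \<noteq> t" "\<bar>s - t\<bar> < r"
    using assms(2,3) by (metis islimpt_approachable dist_real_def)
  then have "((\<lambda>x. \<Sum>k. a k * x ^ k) has_real_derivative (\<Sum>k. diffs a k * 0 ^ k)) (at 0)"
    using sums[of s] by (intro termdiffs_strong[where K = "s - t"]) (auto simp: sums_iff)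
  then have "((\<lambda>x. \<Sum>k. a k * x ^ k) has_real_derivative a 1) (at (t - t))"
    by (simp add: diffs_def)
  moreover have "((\<lambda>s. s - t) has_real_derivative 1) (at t within S)"
    by (auto intro!: derivative_eq_intros)
  ultimately have "((\<lambda>s. \<Sum>k. a k * (s - t) ^ k) has_real_derivative a 1 * 1) (at t within S)"
    by (rule DERIV_chain2)
  then have "(f has_real_derivative a 1 * 1) (at t within S)"
    by (rule has_field_derivative_transform_within[OF _ assms(3,1)])
      (use sums in \<open>auto simp: sums_iff dist_real_def\<close>)
  then show ?thesis by simp
qed

lemma analytic_on_nonneg_differentiable:
  assumes "analytic_on_nonneg f" and "t \<ge> 0"
  obtains D where "(f has_real_derivative D) (at t within {0..})"
proof -
  obtain r c where "r > 0" "\<And>s. s \<ge> 0 \<Longrightarrow> \<bar>s - t\<bar> < r \<Longrightarrow> (\<lambda>k. c k * (s - t) ^ k) sums f s"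
    using assms unfolding analytic_on_nonneg_def by blast
  then have "(f has_real_derivative c 1) (at t within {0..})"
    using assms(2) by (intro power_series_has_real_derivative islimpt_atLeast) auto
  then show thesis by (rule that)
qed

lemma has_sum_imp_sums_fibres:
  fixes f :: "'a \<Rightarrow> 'b :: banach" and g :: "'a \<Rightarrow> nat"
  assumes "(f has_sum s) A"
  shows "(\<lambda>k. \<Sum>\<^sub>\<infinity>x\<in>{x\<in>A. g x = k}. f x) sums s"
proof -
  let ?B = "\<lambda>k. {x\<in>A. g x = k}"
  have "bij_betw snd (Sigma UNIV ?B) A"
    by (rule bij_betw_byWitness[where f' = "\<lambda>x. (g x, x)"]) auto
  then have "((\<lambda>p. f (snd p)) has_sum s) (Sigma UNIV ?B)"
    using assms by (simp add: has_sum_reindex_bij_betw)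
  then have "((\<lambda>k. infsum f (?B k)) has_sum s) UNIV"
  proof (rule has_sum_SigmaD)
    fix k
    have "f summable_on ?B k"
      using has_sum_imp_summable[OF assms] by (rule summable_on_subset_banach) auto
    then show "((\<lambda>x. f (snd (k, x))) has_sum infsum f (?B k)) (?B k)"
      by simp
  qed
  then show ?thesis by (rule has_sum_imp_sums)
qed

definition multi_indices :: "nat \<Rightarrow> nat \<Rightarrow> (nat \<Rightarrow> nat \<Rightarrow> nat) set" where
  "multi_indices m n = {\<alpha>. \<forall>i j. (m \<le> i \<or> n \<le> j) \<longrightarrow> \<alpha> i j = 0}"

definition multi_degree :: "nat \<Rightarrow> nat \<Rightarrow> (nat \<Rightarrow> nat \<Rightarrow> nat) \<Rightarrow> nat" where
  "multi_degree m n \<alpha> = (\<Sum>i<m. \<Sum>j<n. \<alpha> i j)"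

definition unit_multi_index :: "nat \<times> nat \<Rightarrow> nat \<Rightarrow> nat \<Rightarrow> nat" where
  "unit_multi_index p = (\<lambda>i j. if (i, j) = p then 1 else 0)"

definition mat_monomial :: "nat \<Rightarrow> nat \<Rightarrow> real mat \<Rightarrow> (nat \<Rightarrow> nat \<Rightarrow> nat) \<Rightarrow> real" where
  "mat_monomial m n H \<alpha> = (\<Prod>i<m. \<Prod>j<n. (H $$ (i,j)) ^ \<alpha> i j)"

lemma inj_unit_multi_index: "inj unit_multi_index"
proof (rule injI)
  fix p q assume "unit_multi_index p = unit_multi_index q"
  then have "unit_multi_index p (fst p) (snd p) = unit_multi_index q (fst p) (snd p)"
    by simp
  then show "p = q" by (simp add: unit_multi_index_def split: if_splits)
qed

lemma multi_indices_degree_1: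
  "{\<alpha> \<in> multi_indices m n. multi_degree m n \<alpha> = 1} = unit_multi_index ` ({..<m} \<times> {..<n})"
proof (intro equalityI subsetI)
  fix \<alpha> assume "\<alpha> \<in> {\<alpha> \<in> multi_indices m n. multi_degree m n \<alpha> = 1}"
  then have supp: "\<And>i j. m \<le> i \<or> n \<le> j \<Longrightarrow> \<alpha> i j = 0"
    and "(\<Sum>(i, j)\<in>{..<m} \<times> {..<n}. \<alpha> i j) = 1"
    by (auto simp: multi_indices_def multi_degree_def sum.cartesian_product)
  then obtain p where p: "p \<in> {..<m} \<times> {..<n}" "case_prod \<alpha> p = 1"
    and other: "\<And>q. q \<in> {..<m} \<times> {..<n} \<Longrightarrow> p \<noteq> q \<Longrightarrow> case_prod \<alpha> q = 0"
    by (subst (asm) sum_eq_1_iff) auto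
  have "\<alpha> i j = unit_multi_index p i j" for i j
    using p other[of "(i, j)"] supp[of i j]
    by (cases "(i, j) = p"; cases "m \<le> i \<or> n \<le> j") (auto simp: unit_multi_index_def not_le)
  then show "\<alpha> \<in> unit_multi_index ` ({..<m} \<times> {..<n})"
    using p(1) by blast
next
  fix \<alpha> assume "\<alpha> \<in> unit_multi_index ` ({..<m} \<times> {..<n})"
  then show "\<alpha> \<in> {\<alpha> \<in> multi_indices m n. multi_degree m n \<alpha> = 1}"
    by (auto simp: multi_indices_def multi_degree_def unit_multi_index_def
        sum.cartesian_product case_prod_unfold sum.delta)
qed

lemma mat_monomial_unit_multi_index:
  assumes "p \<in> {..<m} \<times> {..<n}"
  shows "mat_monomial m n H (unit_multi_index p) = H $$ p"
proof -
  have "mat_monomial m n H (unit_multi_index p) = (\<Prod>q\<in>{..<m} \<times> {..<n}. if q = p then H $$ q else 1)"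
    unfolding mat_monomial_def prod.cartesian_product
    by (intro prod.cong) (auto simp: unit_multi_index_def)
  then show ?thesis using assms by (simp add: prod.delta)
qed

lemma mat_monomial_smult:
  assumes "H \<in> carrier_mat m n"
  shows "mat_monomial m n (h \<cdot>\<^sub>m H) \<alpha> = h ^ multi_degree m n \<alpha> * mat_monomial m n H \<alpha>"
  using assms
  by (simp add: mat_monomial_def multi_degree_def power_mult_distrib prod.distrib power_sum)

lemma mat_entries_bounded:
  fixes H :: "real mat"
  obtains B where "B > 0" and "\<And>i j. i < m \<Longrightarrow> j < n \<Longrightarrow> \<bar>H $$ (i,j)\<bar> < B"
proof
  let ?N = "\<Sum>p\<in>{..<m} \<times> {..<n}. \<bar>H $$ p\<bar>"
  show "1 + ?N > 0" by (simp add: add_pos_nonneg sum_nonneg)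
  fix i j assume "i < m" "j < n"
  then have "\<bar>H $$ (i,j)\<bar> \<le> ?N" by (intro member_le_sum) auto
  then show "\<bar>H $$ (i,j)\<bar> < 1 + ?N" by simp
qed

text \<open>Grouping the monomials of a multivariate series by degree turns its restriction to a line
  into a power series in one variable.\<close>

lemma mat_series_along_line:
  assumes "r > 0" and H: "H \<in> carrier_mat m n"
    and expansion: "\<And>H. H \<in> carrier_mat m n \<Longrightarrow> \<forall>i<m. \<forall>j<n. \<bar>H $$ (i,j)\<bar> < r \<Longrightarrow>
      ((\<lambda>\<alpha>. c \<alpha> * mat_monomial m n H \<alpha>) has_sum f (X + H)) (multi_indices m n)"
  obtains \<delta> where "\<delta> > 0" and "\<And>h. \<bar>h\<bar> < \<delta> \<Longrightarrow>
    (\<lambda>k. (\<Sum>\<^sub>\<infinity>\<alpha>\<in>{\<alpha> \<in> multi_indices m n. multi_degree m n \<alpha> = k}. c \<alpha> * mat_monomial m n H \<alpha>) * h ^ k)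
      sums f (X + h \<cdot>\<^sub>m H)"
proof -
  let ?fibre = "\<lambda>k. {\<alpha> \<in> multi_indices m n. multi_degree m n \<alpha> = k}"
  obtain B where B: "B > 0" "\<And>i j. i < m \<Longrightarrow> j < n \<Longrightarrow> \<bar>H $$ (i,j)\<bar> < B"
    using mat_entries_bounded by blast
  show thesis
  proof (rule that[of "r / B"])
    show "r / B > 0" using \<open>r > 0\<close> B(1) by simp
    fix h :: real assume h: "\<bar>h\<bar> < r / B"
    have "\<bar>(h \<cdot>\<^sub>m H) $$ (i,j)\<bar> < r" if "i < m" "j < n" for i j
    proof -
      have "\<bar>h\<bar> * \<bar>H $$ (i,j)\<bar> \<le> \<bar>h\<bar> * B"
        using B(2)[OF that] by (intro mult_left_mono) auto
      also have "\<dots> < r" using h B(1) by (simp add: field_simps)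
      finally show ?thesis using H that by (simp add: abs_mult)
    qed
    then have "((\<lambda>\<alpha>. c \<alpha> * mat_monomial m n (h \<cdot>\<^sub>m H) \<alpha>) has_sum f (X + h \<cdot>\<^sub>m H)) (multi_indices m n)"
      using H by (intro expansion) auto
    from has_sum_imp_sums_fibres[OF this, of "multi_degree m n"]
    have "(\<lambda>k. \<Sum>\<^sub>\<infinity>\<alpha>\<in>?fibre k. c \<alpha> * mat_monomial m n (h \<cdot>\<^sub>m H) \<alpha>) sums f (X + h \<cdot>\<^sub>m H)" .
    moreover have "(\<Sum>\<^sub>\<infinity>\<alpha>\<in>?fibre k. c \<alpha> * mat_monomial m n (h \<cdot>\<^sub>m H) \<alpha>)
        = (\<Sum>\<^sub>\<infinity>\<alpha>\<in>?fibre k. c \<alpha> * mat_monomial m n H \<alpha>) * h ^ k" for k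
      unfolding infsum_cmult_left'[symmetric]
      by (intro infsum_cong) (simp add: mat_monomial_smult[OF H])
    ultimately show "(\<lambda>k. (\<Sum>\<^sub>\<infinity>\<alpha>\<in>?fibre k. c \<alpha> * mat_monomial m n H \<alpha>) * h ^ k)
        sums f (X + h \<cdot>\<^sub>m H)"
      by simp
  qed
qed

lemma analytic_mat_fun_linear_derivative:
  assumes "analytic_mat_fun m n f" and "X \<in> carrier_mat m n"
  obtains G where "G \<in> carrier_mat m n"
    and "\<And>H. H \<in> carrier_mat m n \<Longrightarrow>
      ((\<lambda>h. f (X + h \<cdot>\<^sub>m H)) has_real_derivative frob_inner G H) (at 0)"
proof -
  obtain r c where "r > 0" and expansion:
    "\<And>H. H \<in> carrier_mat m n \<Longrightarrow> \<forall>i<m. \<forall>j<n. \<bar>H $$ (i,j)\<bar> < r \<Longrightarrow>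
      ((\<lambda>\<alpha>. c \<alpha> * mat_monomial m n H \<alpha>) has_sum f (X + H)) (multi_indices m n)"
    using assms unfolding analytic_mat_fun_def multi_indices_def mat_monomial_def by blast
  define G where "G = mat m n (\<lambda>p. c (unit_multi_index p))"
  show thesis
  proof (rule that)
    show "G \<in> carrier_mat m n" by (simp add: G_def)
    fix H :: "real mat" assume H: "H \<in> carrier_mat m n"
    define a where
      "a k = (\<Sum>\<^sub>\<infinity>\<alpha>\<in>{\<alpha> \<in> multi_indices m n. multi_degree m n \<alpha> = k}. c \<alpha> * mat_monomial m n H \<alpha>)" for k
    obtain \<delta> where "\<delta> > 0" "\<And>h. \<bar>h\<bar> < \<delta> \<Longrightarrow> (\<lambda>k. a k * h ^ k) sums f (X + h \<cdot>\<^sub>m H)"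
      using mat_series_along_line[OF \<open>r > 0\<close> H expansion] unfolding a_def by blast
    then have "((\<lambda>h. f (X + h \<cdot>\<^sub>m H)) has_real_derivative a 1) (at 0)"
      by (intro power_series_has_real_derivative) (auto simp: islimpt_UNIV)
    also have "a 1 = (\<Sum>p\<in>{..<m} \<times> {..<n}. c (unit_multi_index p) * H $$ p)"
      unfolding a_def multi_indices_degree_1
      by (simp add: sum.reindex inj_on_subset[OF inj_unit_multi_index] mat_monomial_unit_multi_index
          cong: sum.cong)
    also have "\<dots> = frob_inner G H"
      by (auto simp: frob_inner_def G_def sum.cartesian_product intro!: sum.cong)
    finally show "((\<lambda>h. f (X + h \<cdot>\<^sub>m H)) has_real_derivative frob_inner G H) (at 0)" .
  qed
qed

section \<open>Gradients of functions of a matrix\<close>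

lemma frob_inner_unit_entry_mat:
  assumes "G \<in> carrier_mat r c" and "i < r" and "j < c"
  shows "frob_inner G (unit_entry_mat r c i j) = G $$ (i,j)"
proof -
  have "frob_inner G (unit_entry_mat r c i j)
      = (\<Sum>a<r. \<Sum>b<c. if b = j then (if a = i then G $$ (a,b) else 0) else 0)"
    using assms unfolding frob_inner_def by (intro sum.cong) (auto simp: unit_entry_mat_def)
  then show ?thesis using assms by (simp add: sum.delta)
qed

lemma dim_grad_mat [simp]: "dim_row (grad_mat f M) = dim_row M" "dim_col (grad_mat f M) = dim_col M"
  by (simp_all add: grad_mat_def)

lemma grad_mat_carrier: "M \<in> carrier_mat r c \<Longrightarrow> grad_mat f M \<in> carrier_mat r c"
  by auto

lemma grad_mat_eqI:
  assumes M: "M \<in> carrier_mat r c" and G: "G \<in> carrier_mat r c"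
    and deriv: "\<And>H. H \<in> carrier_mat r c \<Longrightarrow>
      ((\<lambda>h. f (M + h \<cdot>\<^sub>m H)) has_real_derivative frob_inner G H) (at 0)"
  shows "grad_mat f M = G"
proof (rule eq_matI)
  fix i j assume "i < dim_row G" "j < dim_col G"
  then have ij: "i < r" "j < c" using G by auto
  have "unit_entry_mat r c i j \<in> carrier_mat r c" by (simp add: unit_entry_mat_def)
  from DERIV_imp_deriv[OF deriv[OF this]] show "grad_mat f M $$ (i,j) = G $$ (i,j)"
    using M G ij by (simp add: grad_mat_def frob_inner_unit_entry_mat)
qed (use M G in \<open>auto simp: grad_mat_def\<close>)

lemma analytic_mat_fun_directional_derivative:
  assumes "analytic_mat_fun m n f" and X: "X \<in> carrier_mat m n" and H: "H \<in> carrier_mat m n"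
  shows "((\<lambda>h. f (X + h \<cdot>\<^sub>m H)) has_real_derivative frob_inner (grad_mat f X) H) (at 0)"
proof -
  obtain G where "G \<in> carrier_mat m n" and deriv: "\<And>H. H \<in> carrier_mat m n \<Longrightarrow>
      ((\<lambda>h. f (X + h \<cdot>\<^sub>m H)) has_real_derivative frob_inner G H) (at 0)"
    using analytic_mat_fun_linear_derivative[OF assms(1) X] by blast
  then have "grad_mat f X = G" using X by (intro grad_mat_eqI)
  then show ?thesis using deriv[OF H] by simp
qed

section \<open>Symmetric positive semidefinite matrices\<close>

definition psd_mat :: "nat \<Rightarrow> real mat \<Rightarrow> bool" where
  "psd_mat n A \<longleftrightarrow> A \<in> carrier_mat n n \<and> A\<^sup>T = A \<and> (\<forall>x\<in>carrier_vec n. 0 \<le> x \<bullet> (A *\<^sub>v x))"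

lemma psd_mat_nonneg: "psd_mat n A \<Longrightarrow> x \<in> carrier_vec n \<Longrightarrow> 0 \<le> x \<bullet> (A *\<^sub>v x)"
  by (simp add: psd_mat_def)

lemma symmetric_scalar_prod:
  fixes A :: "'a :: comm_semiring_0 mat"
  assumes "A \<in> carrier_mat n n" and "A\<^sup>T = A" and "x \<in> carrier_vec n" and "y \<in> carrier_vec n"
  shows "x \<bullet> (A *\<^sub>v y) = (A *\<^sub>v x) \<bullet> y"
  using transpose_vec_mult_scalar[OF assms(1,4,3)] assms(2) by simp

lemma psd_mat_one: "psd_mat n (1\<^sub>m n)"
  by (auto simp: psd_mat_def scalar_prod_def intro: sum_nonneg)

lemma psd_mat_congruence:
  assumes "psd_mat p B" and M: "M \<in> carrier_mat p n"
  shows "psd_mat n (M\<^sup>T * (B * M))"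
proof -
  have B: "B \<in> carrier_mat p p" "B\<^sup>T = B" and nonneg: "\<And>y. y \<in> carrier_vec p \<Longrightarrow> 0 \<le> y \<bullet> (B *\<^sub>v y)"
    using assms(1) by (auto simp: psd_mat_def)
  have "0 \<le> x \<bullet> (M\<^sup>T * (B * M) *\<^sub>v x)" if x: "x \<in> carrier_vec n" for x
  proof -
    have "x \<bullet> (M\<^sup>T * (B * M) *\<^sub>v x) = x \<bullet> (M\<^sup>T *\<^sub>v (B *\<^sub>v (M *\<^sub>v x)))"
      using B M x by (simp add: assoc_mult_mat_vec_dim)
    also have "\<dots> = (M *\<^sub>v x) \<bullet> (B *\<^sub>v (M *\<^sub>v x))"
      using transpose_vec_mult_scalar[of "M\<^sup>T" n p "B *\<^sub>v (M *\<^sub>v x)" x] B M x by simp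
    finally show ?thesis using nonneg[of "M *\<^sub>v x"] M x by simp
  qed
  then show ?thesis
    using B M by (auto simp: psd_mat_def transpose_mult_dim assoc_mult_mat_dim)
qed

lemma psd_mat_gram:
  assumes "M \<in> carrier_mat n p"
  shows "psd_mat n (M * M\<^sup>T)"
  using psd_mat_congruence[OF psd_mat_one, of "M\<^sup>T" p n] assms by simp

lemma pow_mat_Suc_left:
  assumes "A \<in> carrier_mat n n"
  shows "A ^\<^sub>m Suc i = A * A ^\<^sub>m i"
  using assms by (induction i) (simp_all add: assoc_mult_mat_dim)

lemma psd_mat_pow:
  assumes psd: "psd_mat n A"
  shows "psd_mat n (A ^\<^sub>m i)"
proof (induction i rule: nat_induct2)
  case (step i)
  have A: "A \<in> carrier_mat n n" "A\<^sup>T = A" using psd by (auto simp: psd_mat_def)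
  have "A ^\<^sub>m (i + 2) = A * (A ^\<^sub>m i * A)"
    using pow_mat_Suc_left[OF A(1), of "Suc i"] by simp
  then show ?case using psd_mat_congruence[OF step A(1)] A(2) by simp
qed (use psd psd_mat_one in \<open>auto simp: psd_mat_def\<close>)

lemma pow_mat_eigenvector:
  fixes A :: "'a :: field mat"
  assumes A: "A \<in> carrier_mat n n" and u: "u \<in> carrier_vec n" and "A *\<^sub>v u = \<mu> \<cdot>\<^sub>v u"
  shows "A ^\<^sub>m i *\<^sub>v u = \<mu> ^ i \<cdot>\<^sub>v u"
proof (induction i)
  case 0
  then show ?case using A u by simp
next
  case (Suc i)
  have "A ^\<^sub>m Suc i *\<^sub>v u = A ^\<^sub>m i *\<^sub>v (\<mu> \<cdot>\<^sub>v u)"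
    using A u assms(3) by (simp add: assoc_mult_mat_vec_dim)
  also have "\<dots> = \<mu> ^ Suc i \<cdot>\<^sub>v u"
    using mult_mat_vec[OF pow_carrier_mat[OF A] u] Suc by (simp add: smult_smult_assoc)
  finally show ?case .
qed

lemma scalar_prod_self_eq_0_iff:
  fixes w :: "real vec"
  assumes "w \<in> carrier_vec n"
  shows "w \<bullet> w = 0 \<longleftrightarrow> w = 0\<^sub>v n"
  using conjugate_square_eq_0_vec[OF assms] by simp

lemma symmetric_pow_mat_kernel:
  fixes A :: "real mat"
  assumes A: "A \<in> carrier_mat n n" "A\<^sup>T = A" and u: "u \<in> carrier_vec n"
    and "A ^\<^sub>m Suc i *\<^sub>v u = 0\<^sub>v n"
  shows "A *\<^sub>v u = 0\<^sub>v n"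
  using assms(4)
proof (induction i)
  case 0
  then show ?case using A u by simp
next
  case (Suc i)
  define z where "z = A ^\<^sub>m i *\<^sub>v u"
  have z: "z \<in> carrier_vec n" using pow_carrier_mat[OF A(1), of i] u by (simp add: z_def)
  have Az: "A ^\<^sub>m Suc i *\<^sub>v u = A *\<^sub>v z"
    unfolding pow_mat_Suc_left[OF A(1)] z_def using A u by (simp add: assoc_mult_mat_vec_dim)
  have "A *\<^sub>v (A *\<^sub>v z) = A ^\<^sub>m Suc (Suc i) *\<^sub>v u"
    unfolding pow_mat_Suc_left[OF A(1), of "Suc i"] Az[symmetric]
    using A u by (simp add: assoc_mult_mat_vec_dim)
  then have "(A *\<^sub>v z) \<bullet> (A *\<^sub>v z) = 0"
    using Suc.prems symmetric_scalar_prod[OF A z, of "A *\<^sub>v z"] A z by simp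
  then have "A *\<^sub>v z = 0\<^sub>v n"
    using scalar_prod_self_eq_0_iff[of "A *\<^sub>v z" n] A z by simp
  then show ?case using Suc.IH Az by simp
qed

lemma pow_mat_diff_telescope:
  fixes A :: "'a :: field mat"
  assumes A: "A \<in> carrier_mat n n" and u: "u \<in> carrier_vec n" and y: "y \<in> carrier_vec n"
  shows "y \<bullet> (A ^\<^sub>m N *\<^sub>v u) - \<mu> ^ N * (y \<bullet> u)
    = (\<Sum>i<N. \<mu> ^ (N - Suc i) * (y \<bullet> (A ^\<^sub>m i *\<^sub>v (A *\<^sub>v u - \<mu> \<cdot>\<^sub>v u))))"
proof (induction N)
  case 0
  then show ?case using A u by simp
next
  case (Suc N)
  let ?term = "\<lambda>i. y \<bullet> (A ^\<^sub>m i *\<^sub>v (A *\<^sub>v u - \<mu> \<cdot>\<^sub>v u))"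
  have AN: "A ^\<^sub>m N \<in> carrier_mat n n" using A by (rule pow_carrier_mat)
  have carrier: "A ^\<^sub>m Suc N *\<^sub>v u \<in> carrier_vec n" "A ^\<^sub>m N *\<^sub>v u \<in> carrier_vec n"
    using pow_carrier_mat[OF A] u by (blast intro: mult_mat_vec_carrier)+
  have "A ^\<^sub>m N *\<^sub>v (A *\<^sub>v u - \<mu> \<cdot>\<^sub>v u) = A ^\<^sub>m Suc N *\<^sub>v u - \<mu> \<cdot>\<^sub>v (A ^\<^sub>m N *\<^sub>v u)"
    using A u mult_minus_distrib_mat_vec[OF AN, of "A *\<^sub>v u" "\<mu> \<cdot>\<^sub>v u"] mult_mat_vec[OF AN u]
    by (simp add: assoc_mult_mat_vec_dim)
  then have last: "?term N = y \<bullet> (A ^\<^sub>m Suc N *\<^sub>v u) - \<mu> * (y \<bullet> (A ^\<^sub>m N *\<^sub>v u))"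
    using y carrier by (simp add: scalar_prod_minus_distrib[of _ n] del: pow_mat.simps)
  have "(\<Sum>i<Suc N. \<mu> ^ (Suc N - Suc i) * ?term i)
      = \<mu> * (\<Sum>i<N. \<mu> ^ (N - Suc i) * ?term i) + ?term N"
    by (simp add: sum_distrib_left Suc_diff_Suc[symmetric] mult.assoc)
  also have "\<dots> = y \<bullet> (A ^\<^sub>m Suc N *\<^sub>v u) - \<mu> ^ Suc N * (y \<bullet> u)"
    unfolding Suc.IH[symmetric] last by (simp add: algebra_simps)
  finally show ?case by simp
qed

text \<open>With \<open>w = A u - \<mu> u\<close>, the factorisation of \<open>A^N - \<mu>^N\<close> gives
  \<open>0 = (\<Sum>i<N. \<mu>^(N-1-i) * (w \<bullet> A^i w))\<close>, a sum of nonnegative terms; no spectral theorem is needed.\<close>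

lemma psd_mat_pow_eigenvector:
  assumes psd: "psd_mat n A" and u: "u \<in> carrier_vec n" and "\<mu> \<ge> 0" and "N > 0"
    and pow: "A ^\<^sub>m N *\<^sub>v u = \<mu> ^ N \<cdot>\<^sub>v u"
  shows "A *\<^sub>v u = \<mu> \<cdot>\<^sub>v u"
proof (cases "\<mu> = 0")
  case True
  have "A ^\<^sub>m Suc (N - 1) *\<^sub>v u = 0\<^sub>v n"
    using pow u True \<open>N > 0\<close> by (auto simp del: pow_mat.simps)
  then show ?thesis
    using symmetric_pow_mat_kernel[of A n u "N - 1"] psd u True by (auto simp: psd_mat_def)
next
  case False
  have A: "A \<in> carrier_mat n n" using psd by (simp add: psd_mat_def)
  define w where "w = A *\<^sub>v u - \<mu> \<cdot>\<^sub>v u"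
  have w: "w \<in> carrier_vec n" using A u by (simp add: w_def)
  have "(\<Sum>i<N. \<mu> ^ (N - Suc i) * (w \<bullet> (A ^\<^sub>m i *\<^sub>v w))) = 0"
    using pow_mat_diff_telescope[OF A u w, of N \<mu>] pow u w by (simp add: w_def[symmetric])
  moreover have "0 \<le> \<mu> ^ (N - Suc i) * (w \<bullet> (A ^\<^sub>m i *\<^sub>v w))" for i
    using psd_mat_pow[OF psd, of i] w \<open>\<mu> \<ge> 0\<close> by (simp add: psd_mat_def)
  ultimately have "\<forall>i\<in>{..<N}. \<mu> ^ (N - Suc i) * (w \<bullet> (A ^\<^sub>m i *\<^sub>v w)) = 0"
    by (simp only: sum_nonneg_eq_0_iff finite_lessThan)
  from bspec[OF this, of 0] have "w \<bullet> w = 0"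
    using False \<open>N > 0\<close> A w by simp
  then have "w = 0\<^sub>v n"
    using scalar_prod_self_eq_0_iff[OF w] by simp
  then have "(A *\<^sub>v u - \<mu> \<cdot>\<^sub>v u) $ i = 0" if "i < n" for i
    using that by (simp add: w_def)
  then show ?thesis using A u by (intro eq_vecI) auto
qed

section \<open>The adaptive Laplacian\<close>

definition graph_laplacian :: "real mat \<Rightarrow> real mat" where
  "graph_laplacian A = mat (dim_row A) (dim_row A)
     (\<lambda>(i,j). if i = j then (\<Sum>k<dim_row A. A $$ (i,k)) else 0) - A"

lemma graph_laplacian_mult_vec:
  assumes A: "A \<in> carrier_mat p p" and x: "x \<in> carrier_vec p" and i: "i < p"
  shows "(graph_laplacian A *\<^sub>v x) $ i = (\<Sum>j<p. A $$ (i,j) * (x $ i - x $ j))"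
proof -
  have "(graph_laplacian A *\<^sub>v x) $ i
      = (\<Sum>j<p. (if i = j then (\<Sum>k<p. A $$ (i,k)) * x $ i else 0) - A $$ (i,j) * x $ j)"
    using assms
    by (auto simp: graph_laplacian_def scalar_prod_def lessThan_atLeast0 algebra_simps intro!: sum.cong)
  also have "\<dots> = (\<Sum>j<p. A $$ (i,j)) * x $ i - (\<Sum>j<p. A $$ (i,j) * x $ j)"
    using i by (simp add: sum_subtractf)
  also have "\<dots> = (\<Sum>j<p. A $$ (i,j) * (x $ i - x $ j))"
    by (simp add: right_diff_distrib sum_subtractf sum_distrib_right)
  finally show ?thesis .
qed

lemma graph_laplacian_quadratic_form:
  assumes A: "A \<in> carrier_mat p p" "A\<^sup>T = A" and x: "x \<in> carrier_vec p"
  shows "2 * (x \<bullet> (graph_laplacian A *\<^sub>v x)) = (\<Sum>i<p. \<Sum>j<p. A $$ (i,j) * (x $ i - x $ j)\<^sup>2)"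
proof -
  have sym: "A $$ (i,j) = A $$ (j,i)" if "i < p" "j < p" for i j
    using A that by (metis carrier_matD index_transpose_mat(1))
  have "x \<bullet> (graph_laplacian A *\<^sub>v x) = (\<Sum>i<p. x $ i * (graph_laplacian A *\<^sub>v x) $ i)"
    using A(1) by (simp add: scalar_prod_def lessThan_atLeast0 graph_laplacian_def)
  also have "\<dots> = (\<Sum>i<p. \<Sum>j<p. A $$ (i,j) * x $ i * (x $ i - x $ j))"
    by (simp add: graph_laplacian_mult_vec[OF A(1) x] sum_distrib_left algebra_simps)
  finally have form: "x \<bullet> (graph_laplacian A *\<^sub>v x) = \<dots>" .
  also have "\<dots> = (\<Sum>i<p. \<Sum>j<p. A $$ (i,j) * x $ j * (x $ j - x $ i))"
    by (subst sum.swap) (auto simp: sym intro!: sum.cong)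
  finally have "2 * (x \<bullet> (graph_laplacian A *\<^sub>v x))
      = (\<Sum>i<p. \<Sum>j<p. A $$ (i,j) * x $ i * (x $ i - x $ j) + A $$ (i,j) * x $ j * (x $ j - x $ i))"
    using form by (simp only: sum.distrib)
  also have "\<dots> = (\<Sum>i<p. \<Sum>j<p. A $$ (i,j) * (x $ i - x $ j)\<^sup>2)"
    by (simp add: power2_eq_square algebra_simps)
  finally show ?thesis .
qed

lemma psd_mat_graph_laplacian:
  assumes A: "A \<in> carrier_mat p p" "A\<^sup>T = A" and nonneg: "\<And>i j. i < p \<Longrightarrow> j < p \<Longrightarrow> 0 \<le> A $$ (i,j)"
  shows "psd_mat p (graph_laplacian A)"
  unfolding psd_mat_def
proof (intro conjI ballI)
  show "graph_laplacian A \<in> carrier_mat p p"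
    using A(1) by (simp add: graph_laplacian_def minus_carrier_mat)
  have "A $$ (i,j) = A $$ (j,i)" if "i < p" "j < p" for i j
    using A that by (metis carrier_matD index_transpose_mat(1))
  then show "(graph_laplacian A)\<^sup>T = graph_laplacian A"
    using A(1) by (intro eq_matI) (auto simp: graph_laplacian_def)
  fix x :: "real vec" assume "x \<in> carrier_vec p"
  moreover have "0 \<le> (\<Sum>i<p. \<Sum>j<p. A $$ (i,j) * (x $ i - x $ j)\<^sup>2)"
    by (intro sum_nonneg mult_nonneg_nonneg) (auto simp: nonneg)
  ultimately show "0 \<le> x \<bullet> (graph_laplacian A *\<^sub>v x)"
    using graph_laplacian_quadratic_form[OF A, of x] by simp
qed

lemma psd_mat_adaptive_laplacian: "psd_mat p (adaptive_laplacian p W)"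
proof -
  have carrier: "adaptive_adj p W \<in> carrier_mat p p" by (simp add: adaptive_adj_def)
  have "(adaptive_adj p W)\<^sup>T = adaptive_adj p W"
    by (intro eq_matI) (auto simp: adaptive_adj_def add.commute)
  moreover have "0 \<le> adaptive_adj p W $$ (i,j)" if "i < p" "j < p" for i j
    using that by (simp add: adaptive_adj_def sum_nonneg)
  ultimately have "psd_mat p (graph_laplacian (adaptive_adj p W))"
    by (rule psd_mat_graph_laplacian[OF carrier])
  then show ?thesis
    unfolding adaptive_laplacian_def graph_laplacian_def carrier_matD(1)[OF carrier] .
qed

section \<open>Derivatives of matrix curves\<close>

definition has_mat_derivative ::
    "nat \<Rightarrow> nat \<Rightarrow> (real \<Rightarrow> real mat) \<Rightarrow> real mat \<Rightarrow> real \<Rightarrow> real set \<Rightarrow> bool" where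
  "has_mat_derivative r c F D t T \<longleftrightarrow>
     t \<in> T \<and> (\<forall>s\<in>T. F s \<in> carrier_mat r c) \<and> D \<in> carrier_mat r c \<and>
     (\<forall>i<r. \<forall>j<c. ((\<lambda>s. F s $$ (i,j)) has_real_derivative D $$ (i,j)) (at t within T))"

lemma has_mat_derivativeI:
  assumes "t \<in> T" and "\<And>s. s \<in> T \<Longrightarrow> F s \<in> carrier_mat r c" and "D \<in> carrier_mat r c"
    and deriv: "\<And>i j. i < r \<Longrightarrow> j < c \<Longrightarrow> (f i j has_real_derivative D $$ (i,j)) (at t within T)"
    and entry: "\<And>i j s. i < r \<Longrightarrow> j < c \<Longrightarrow> s \<in> T \<Longrightarrow> F s $$ (i,j) = f i j s"
  shows "has_mat_derivative r c F D t T"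
proof -
  have "((\<lambda>s. F s $$ (i,j)) has_real_derivative D $$ (i,j)) (at t within T)" if "i < r" "j < c" for i j
    by (rule has_field_derivative_transform_within[OF deriv[OF that], where d = 1])
      (use that entry \<open>t \<in> T\<close> in auto)
  then show ?thesis using assms(1-3) by (simp add: has_mat_derivative_def)
qed

lemma has_mat_derivativeD:
  assumes "has_mat_derivative r c F D t T"
  shows "t \<in> T" and "s \<in> T \<Longrightarrow> F s \<in> carrier_mat r c" and "D \<in> carrier_mat r c"
    and "i < r \<Longrightarrow> j < c \<Longrightarrow> ((\<lambda>s. F s $$ (i,j)) has_real_derivative D $$ (i,j)) (at t within T)"
  using assms by (auto simp: has_mat_derivative_def)

lemma has_mat_derivative_const:
  assumes "C \<in> carrier_mat r c" and "t \<in> T"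
  shows "has_mat_derivative r c (\<lambda>_. C) (0\<^sub>m r c) t T"
  using assms by (simp add: has_mat_derivative_def)

lemma has_mat_derivative_transpose:
  assumes F: "has_mat_derivative r c F D t T"
  shows "has_mat_derivative c r (\<lambda>s. (F s)\<^sup>T) D\<^sup>T t T"
proof (rule has_mat_derivativeI)
  fix i j assume "i < c" "j < r"
  then show "((\<lambda>s. F s $$ (j,i)) has_real_derivative D\<^sup>T $$ (i,j)) (at t within T)"
    using has_mat_derivativeD(3,4)[OF F] by simp
next
  fix i j s assume "i < c" "j < r" "s \<in> T"
  then show "(F s)\<^sup>T $$ (i,j) = F s $$ (j,i)"
    using has_mat_derivativeD(2)[OF F \<open>s \<in> T\<close>] by simp
qed (use has_mat_derivativeD[OF F] in auto)

lemma has_mat_derivative_mult: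
  assumes F: "has_mat_derivative r c F D t T" and G: "has_mat_derivative c e G E t T"
  shows "has_mat_derivative r e (\<lambda>s. F s * G s) (D * G t + F t * E) t T"
proof (rule has_mat_derivativeI)
  note carriers = has_mat_derivativeD(1-3)[OF F] has_mat_derivativeD(2,3)[OF G]
  show "F s * G s \<in> carrier_mat r e" if "s \<in> T" for s
    using carriers(2)[OF that] carriers(4)[OF that] by simp
  show "D * G t + F t * E \<in> carrier_mat r e"
    using carriers(2,4)[OF carriers(1)] carriers(3,5) by simp
  fix i j assume ij: "i < r" "j < e"
  have "((\<lambda>s. \<Sum>l<c. F s $$ (i,l) * G s $$ (l,j)) has_real_derivative
      (\<Sum>l<c. D $$ (i,l) * G t $$ (l,j) + F t $$ (i,l) * E $$ (l,j))) (at t within T)"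
    using ij
    by (auto intro!: DERIV_sum derivative_eq_intros has_mat_derivativeD(4)[OF F] has_mat_derivativeD(4)[OF G])
  also have "(\<Sum>l<c. D $$ (i,l) * G t $$ (l,j) + F t $$ (i,l) * E $$ (l,j)) = (D * G t + F t * E) $$ (i,j)"
    using carriers(2,4)[OF carriers(1)] carriers(3,5) ij
    by (auto simp: scalar_prod_def lessThan_atLeast0 sum.distrib)
  finally show "((\<lambda>s. \<Sum>l<c. F s $$ (i,l) * G s $$ (l,j)) has_real_derivative
      (D * G t + F t * E) $$ (i,j)) (at t within T)" .
  fix s assume "s \<in> T"
  then show "(F s * G s) $$ (i,j) = (\<Sum>l<c. F s $$ (i,l) * G s $$ (l,j))"
    using carriers(2,4)[of s] ij by (auto simp: scalar_prod_def lessThan_atLeast0)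
qed (rule has_mat_derivativeD(1)[OF F])

lemma has_mat_derivative_unique:
  assumes D: "has_mat_derivative r c F D t T" and E: "has_mat_derivative r c F E t T"
    and "t islimpt T"
  shows "D = E"
proof (rule eq_matI)
  have "at t within T \<noteq> bot" using assms(3) by (simp add: trivial_limit_within)
  then show "D $$ (i,j) = E $$ (i,j)" if "i < dim_row E" "j < dim_col E" for i j
    using has_field_derivative_unique[of _ "D $$ (i,j)" t T "E $$ (i,j)"] that
      has_mat_derivativeD(4)[OF D, of i j] has_mat_derivativeD(4)[OF E, of i j] has_mat_derivativeD(3)[OF E]
    by auto
qed (use has_mat_derivativeD(3)[OF D] has_mat_derivativeD(3)[OF E] in auto)

lemma has_mat_derivative_if_analytic:
  assumes F: "\<And>s. s \<ge> 0 \<Longrightarrow> F s \<in> carrier_mat r c"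
    and analytic: "\<And>i j. i < r \<Longrightarrow> j < c \<Longrightarrow> analytic_on_nonneg (\<lambda>s. F s $$ (i,j))" and "t \<ge> 0"
  obtains D where "has_mat_derivative r c F D t {0..}"
proof -
  have "\<exists>D. ((\<lambda>s. F s $$ (i,j)) has_real_derivative D) (at t within {0..})" if "i < r" "j < c" for i j
    using analytic_on_nonneg_differentiable[OF analytic[OF that] \<open>t \<ge> 0\<close>] by blast
  then obtain D where "\<And>i j. i < r \<Longrightarrow> j < c \<Longrightarrow>
      ((\<lambda>s. F s $$ (i,j)) has_real_derivative D i j) (at t within {0..})"
    by metis
  then have "has_mat_derivative r c F (mat r c (\<lambda>(i,j). D i j)) t {0..}"
    using F \<open>t \<ge> 0\<close> by (simp add: has_mat_derivative_def)
  then show thesis by (rule that)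
qed

lemma mat_curves_eqI:
  assumes F: "\<And>s. s \<in> T \<Longrightarrow> has_mat_derivative r c F (D s) s T"
    and G: "\<And>s. s \<in> T \<Longrightarrow> has_mat_derivative r c G (D s) s T"
    and "convex T" and "t\<^sub>0 \<in> T" and "F t\<^sub>0 = G t\<^sub>0" and t: "t \<in> T"
  shows "F t = G t"
proof (rule eq_matI)
  have carriers: "F t \<in> carrier_mat r c" "G t \<in> carrier_mat r c"
    using has_mat_derivativeD(2)[OF F[OF t] t] has_mat_derivativeD(2)[OF G[OF t] t] by auto
  then show "dim_row (F t) = dim_row (G t)" "dim_col (F t) = dim_col (G t)" by auto
  fix i j assume "i < dim_row (G t)" "j < dim_col (G t)"
  then have ij: "i < r" "j < c" using carriers by auto
  have "((\<lambda>s. F s $$ (i,j) - G s $$ (i,j)) has_real_derivative 0) (at s within T)" if "s \<in> T" for s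
    using DERIV_diff[OF has_mat_derivativeD(4)[OF F[OF that] ij] has_mat_derivativeD(4)[OF G[OF that] ij]]
    by simp
  then obtain a where "\<And>s. s \<in> T \<Longrightarrow> F s $$ (i,j) - G s $$ (i,j) = a"
    using has_field_derivative_zero_constant[OF \<open>convex T\<close>, of "\<lambda>s. F s $$ (i,j) - G s $$ (i,j)"]
    by blast
  from this[OF \<open>t\<^sub>0 \<in> T\<close>] this[OF t] show "F t $$ (i,j) = G t $$ (i,j)"
    using \<open>F t\<^sub>0 = G t\<^sub>0\<close> by simp
qed

lemma gram_balance_conserved:
  assumes A: "\<And>s. s \<in> T \<Longrightarrow> has_mat_derivative q p A (A' s) s T"
    and B: "\<And>s. s \<in> T \<Longrightarrow> has_mat_derivative p r B (B' s) s T"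
    and velocities: "\<And>s. s \<in> T \<Longrightarrow> (A s)\<^sup>T * A' s = B' s * (B s)\<^sup>T"
    and "convex T" and "t\<^sub>0 \<in> T" and "(A t\<^sub>0)\<^sup>T * A t\<^sub>0 = B t\<^sub>0 * (B t\<^sub>0)\<^sup>T" and "t \<in> T"
  shows "(A t)\<^sup>T * A t = B t * (B t)\<^sup>T"
proof (rule mat_curves_eqI[where D = "\<lambda>s. (B' s * (B s)\<^sup>T)\<^sup>T + B' s * (B s)\<^sup>T"])
  fix s assume s: "s \<in> T"
  note carriers = has_mat_derivativeD(2)[OF A[OF s] s] has_mat_derivativeD(3)[OF A[OF s]]
    has_mat_derivativeD(2)[OF B[OF s] s] has_mat_derivativeD(3)[OF B[OF s]]
  have "(A' s)\<^sup>T * A s = (B' s * (B s)\<^sup>T)\<^sup>T"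
    unfolding velocities[OF s, symmetric] using carriers by (simp add: transpose_mult_dim)
  then show "has_mat_derivative p p (\<lambda>s. (A s)\<^sup>T * A s) ((B' s * (B s)\<^sup>T)\<^sup>T + B' s * (B s)\<^sup>T) s T"
    using has_mat_derivative_mult[OF has_mat_derivative_transpose[OF A[OF s]] A[OF s]] velocities[OF s]
    by simp
  have "B s * (B' s)\<^sup>T = (B' s * (B s)\<^sup>T)\<^sup>T"
    using carriers by (simp add: transpose_mult_dim)
  moreover have "B' s * (B s)\<^sup>T + (B' s * (B s)\<^sup>T)\<^sup>T = (B' s * (B s)\<^sup>T)\<^sup>T + B' s * (B s)\<^sup>T"
    using carriers by (intro comm_add_mat[of _ p p]) auto
  ultimately show "has_mat_derivative p p (\<lambda>s. B s * (B s)\<^sup>T) ((B' s * (B s)\<^sup>T)\<^sup>T + B' s * (B s)\<^sup>T) s T"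
    using has_mat_derivative_mult[OF B[OF s] has_mat_derivative_transpose[OF B[OF s]]] by simp
qed (use assms in auto)

lemma orthonormal_cols_derivative_diag:
  assumes U: "has_mat_derivative q p U U' t T" and orth: "\<And>s. s \<in> T \<Longrightarrow> (U s)\<^sup>T * U s = 1\<^sub>m p"
    and "t islimpt T" and k: "k < p"
  shows "(U'\<^sup>T * U t) $$ (k,k) = 0"
proof -
  note t = has_mat_derivativeD(1)[OF U]
  note carriers = has_mat_derivativeD(2)[OF U t] has_mat_derivativeD(3)[OF U]
  have deriv: "has_mat_derivative p p (\<lambda>s. (U s)\<^sup>T * U s) (U'\<^sup>T * U t + (U t)\<^sup>T * U') t T"
    by (rule has_mat_derivative_mult[OF has_mat_derivative_transpose[OF U] U])
  have "has_mat_derivative p p (\<lambda>s. (U s)\<^sup>T * U s) (0\<^sub>m p p) t T"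
    by (rule has_mat_derivativeI[where f = "\<lambda>i j _. 1\<^sub>m p $$ (i,j)"]) (use t orth in auto)
  from has_mat_derivative_unique[OF deriv this \<open>t islimpt T\<close>]
  have "(U'\<^sup>T * U t + (U t)\<^sup>T * U') $$ (k,k) = 0"
    using k by simp
  moreover have "(U t)\<^sup>T * U' = (U'\<^sup>T * U t)\<^sup>T"
    using carriers by (simp add: transpose_mult_dim)
  ultimately show ?thesis using carriers k by simp
qed

section \<open>Singular value decompositions\<close>

definition is_svd :: "nat \<Rightarrow> nat \<Rightarrow> real mat \<Rightarrow> real mat \<Rightarrow> real mat \<Rightarrow> real mat \<Rightarrow> bool" where
  "is_svd m n X U S V \<longleftrightarrow>
     U \<in> carrier_mat m m \<and> S \<in> carrier_mat m n \<and> V \<in> carrier_mat n n \<and>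
     U\<^sup>T * U = 1\<^sub>m m \<and> V\<^sup>T * V = 1\<^sub>m n \<and>
     diagonal_mat S \<and> (\<forall>i<min m n. 0 \<le> S $$ (i,i)) \<and> X = U * S * V\<^sup>T"

lemma is_svdI:
  assumes "U \<in> carrier_mat m m" and "S \<in> carrier_mat m n" and "V \<in> carrier_mat n n"
    and "U\<^sup>T * U = 1\<^sub>m m" and "V\<^sup>T * V = 1\<^sub>m n"
    and "\<And>i j. i < m \<Longrightarrow> j < n \<Longrightarrow> i \<noteq> j \<Longrightarrow> S $$ (i,j) = 0"
    and "\<And>i. i < min m n \<Longrightarrow> 0 \<le> S $$ (i,i)" and "X = U * S * V\<^sup>T"
  shows "is_svd m n X U S V"
  using assms by (auto simp: is_svd_def diagonal_mat_def)

lemma is_svd_transpose: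
  assumes "is_svd m n X U S V"
  shows "is_svd n m X\<^sup>T V S\<^sup>T U"
  using assms
  by (auto simp: is_svd_def diagonal_mat_def transpose_mult_dim assoc_mult_mat_dim)

lemma is_svd_mult_right:
  assumes "is_svd m n X U S V"
  shows "X * V = U * S"
  using assms by (auto simp: is_svd_def assoc_mult_mat_dim)

lemma is_svd_diagonalise:
  assumes "is_svd m n X U S V"
  shows "U\<^sup>T * (X * V) = S"
proof -
  have "U\<^sup>T * (X * V) = U\<^sup>T * U * S"
    unfolding is_svd_mult_right[OF assms]
    using assms by (intro assoc_mult_mat_dim[symmetric]) (auto simp: is_svd_def)
  then show ?thesis using assms by (auto simp: is_svd_def)
qed

lemma index_mult_diagonal_mat:
  fixes A S :: "'a :: semiring_0 mat"
  assumes "A \<in> carrier_mat p m" and "S \<in> carrier_mat m n" and "diagonal_mat S"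
    and "i < p" and "k < min m n"
  shows "(A * S) $$ (i,k) = A $$ (i,k) * S $$ (k,k)"
proof -
  have "(A * S) $$ (i,k) = (\<Sum>j\<in>{0..<m}. A $$ (i,j) * S $$ (j,k))"
    using assms by (simp add: scalar_prod_def)
  also have "\<dots> = (\<Sum>j\<in>{0..<m}. if j = k then A $$ (i,k) * S $$ (k,k) else 0)"
    using assms by (intro sum.cong) (auto simp: diagonal_mat_def)
  finally show ?thesis using assms by simp
qed

definition singular_triple :: "nat \<Rightarrow> nat \<Rightarrow> real mat \<Rightarrow> real \<Rightarrow> real vec \<Rightarrow> real vec \<Rightarrow> bool" where
  "singular_triple m n X \<sigma> u v \<longleftrightarrow>
     X \<in> carrier_mat m n \<and> u \<in> carrier_vec m \<and> v \<in> carrier_vec n \<and>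
     X *\<^sub>v v = \<sigma> \<cdot>\<^sub>v u \<and> X\<^sup>T *\<^sub>v u = \<sigma> \<cdot>\<^sub>v v"

lemma singular_tripleD:
  assumes "singular_triple m n X \<sigma> u v"
  shows "X \<in> carrier_mat m n" and "u \<in> carrier_vec m" and "v \<in> carrier_vec n"
    and "X *\<^sub>v v = \<sigma> \<cdot>\<^sub>v u" and "X\<^sup>T *\<^sub>v u = \<sigma> \<cdot>\<^sub>v v"
  using assms by (simp_all add: singular_triple_def)

lemma singular_triple_transpose:
  "singular_triple m n X \<sigma> u v \<Longrightarrow> singular_triple n m X\<^sup>T \<sigma> v u"
  by (simp add: singular_triple_def)

lemma singular_triple_gram:
  assumes "singular_triple m n X \<sigma> u v"
  shows "(X * X\<^sup>T) *\<^sub>v u = \<sigma>\<^sup>2 \<cdot>\<^sub>v u"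
  using singular_tripleD[OF assms] mult_mat_vec[OF singular_tripleD(1,3)[OF assms], of \<sigma>]
  by (simp add: assoc_mult_mat_vec_dim smult_smult_assoc power2_eq_square)

lemma is_svd_mult_col:
  assumes svd: "is_svd m n X U S V" and k: "k < min m n"
  shows "X *\<^sub>v col V k = S $$ (k,k) \<cdot>\<^sub>v col U k"
proof -
  have carriers: "U \<in> carrier_mat m m" "S \<in> carrier_mat m n" "V \<in> carrier_mat n n" "X \<in> carrier_mat m n"
    and diag: "diagonal_mat S"
    using svd by (auto simp: is_svd_def)
  have "X *\<^sub>v col V k = col (U * S) k"
    using carriers k by (simp add: is_svd_mult_right[OF svd, symmetric])
  also have "\<dots> = S $$ (k,k) \<cdot>\<^sub>v col U k"
    using carriers k index_mult_diagonal_mat[OF carriers(1,2) diag _ k]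
    by (intro eq_vecI) (auto simp: mult.commute)
  finally show ?thesis .
qed

lemma is_svd_singular_triple:
  assumes svd: "is_svd m n X U S V" and k: "k < min m n"
  shows "singular_triple m n X (S $$ (k,k)) (col U k) (col V k)"
  using is_svd_mult_col[OF svd k] is_svd_mult_col[OF is_svd_transpose[OF svd], of k] k svd
  by (auto simp: singular_triple_def is_svd_def carrier_vecI)

lemma is_svd_skew_variation:
  assumes svd: "is_svd m n X U S V" and D: "D \<in> carrier_mat m m" and k: "k < min m n"
    and skew: "(D\<^sup>T * U) $$ (k,k) = 0"
  shows "(D\<^sup>T * (X * V)) $$ (k,k) = 0"
proof -
  have carriers: "U \<in> carrier_mat m m" "S \<in> carrier_mat m n" and diag: "diagonal_mat S"
    using svd by (auto simp: is_svd_def)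
  have "D\<^sup>T * (X * V) = (D\<^sup>T * U) * S"
    unfolding is_svd_mult_right[OF svd] using carriers D by (simp add: assoc_mult_mat_dim)
  then show ?thesis
    using index_mult_diagonal_mat[of "D\<^sup>T * U" m m S n k k] carriers D diag k skew by simp
qed

text \<open>The terms of \<open>(U\<^sup>T X V)'\<close> containing \<open>U'\<close> and \<open>V'\<close> are \<open>(U'\<^sup>T U) S\<close> and \<open>S (V\<^sup>T V')\<close>;
  their diagonals vanish because \<open>U'\<^sup>T U\<close> and \<open>V\<^sup>T V'\<close> are skew-symmetric.\<close>

lemma singular_value_derivative:
  assumes U: "has_mat_derivative m m U U' t T" and V: "has_mat_derivative n n V V' t T"
    and X: "has_mat_derivative m n X X' t T"
    and svd: "\<And>s. s \<in> T \<Longrightarrow> is_svd m n (X s) (U s) (S s) (V s)"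
    and limpt: "t islimpt T" and k: "k < min m n"
  shows "((\<lambda>s. S s $$ (k,k)) has_real_derivative col (U t) k \<bullet> (X' *\<^sub>v col (V t) k)) (at t within T)"
proof -
  note t = has_mat_derivativeD(1)[OF U]
  note carriers = has_mat_derivativeD(2)[OF U t] has_mat_derivativeD(2)[OF V t] has_mat_derivativeD(2)[OF X t]
    has_mat_derivativeD(3)[OF U] has_mat_derivativeD(3)[OF V] has_mat_derivativeD(3)[OF X]
  have orth: "\<And>s. s \<in> T \<Longrightarrow> (U s)\<^sup>T * U s = 1\<^sub>m m" "\<And>s. s \<in> T \<Longrightarrow> (V s)\<^sup>T * V s = 1\<^sub>m n"
    using svd by (auto simp: is_svd_def)
  have kmn: "k < m" "k < n" using k by auto
  define E where "E = U'\<^sup>T * (X t * V t) + (U t)\<^sup>T * (X' * V t + X t * V')"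
  have "has_mat_derivative m n (\<lambda>s. (U s)\<^sup>T * (X s * V s)) E t T"
    unfolding E_def
    by (rule has_mat_derivative_mult[OF has_mat_derivative_transpose[OF U] has_mat_derivative_mult[OF X V]])
  from has_mat_derivativeD(4)[OF this kmn]
  have "((\<lambda>s. S s $$ (k,k)) has_real_derivative E $$ (k,k)) (at t within T)"
    by (rule has_field_derivative_transform_within[where d = 1])
      (use t is_svd_diagonalise[OF svd] in auto)
  moreover have "(U'\<^sup>T * (X t * V t)) $$ (k,k) = 0"
    using orthonormal_cols_derivative_diag[OF U orth(1) limpt kmn(1)]
    by (rule is_svd_skew_variation[OF svd[OF t] carriers(4) k])
  moreover have "((U t)\<^sup>T * (X t * V')) $$ (k,k) = 0"
  proof -
    have "(U t)\<^sup>T * (X t * V') = (V'\<^sup>T * ((X t)\<^sup>T * U t))\<^sup>T"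
      using carriers by (simp add: transpose_mult_dim assoc_mult_mat_dim)
    then show ?thesis
      using is_svd_skew_variation[OF is_svd_transpose[OF svd[OF t]] carriers(5), of k]
        orthonormal_cols_derivative_diag[OF V orth(2) limpt kmn(2)] carriers kmn by simp
  qed
  moreover have "(U t)\<^sup>T * (X' * V t + X t * V') = (U t)\<^sup>T * (X' * V t) + (U t)\<^sup>T * (X t * V')"
    using carriers by (intro mult_add_distrib_mat[of _ m m]) auto
  ultimately have "((\<lambda>s. S s $$ (k,k)) has_real_derivative ((U t)\<^sup>T * (X' * V t)) $$ (k,k)) (at t within T)"
    using carriers kmn by (simp add: E_def del: index_mult_mat(1))
  then show ?thesis using carriers kmn by simp
qed

section \<open>Products of layers\<close>

definition layer_chain :: "(nat \<Rightarrow> nat) \<Rightarrow> nat \<Rightarrow> (nat \<Rightarrow> real mat) \<Rightarrow> bool" where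
  "layer_chain d L Ws \<longleftrightarrow> (\<forall>l<L. Ws l \<in> carrier_mat (d (Suc l)) (d l))"

definition balanced_layers :: "nat \<Rightarrow> (nat \<Rightarrow> real mat) \<Rightarrow> bool" where
  "balanced_layers L Ws \<longleftrightarrow> (\<forall>l. Suc l < L \<longrightarrow> (Ws (Suc l))\<^sup>T * Ws (Suc l) = Ws l * (Ws l)\<^sup>T)"

text \<open>\<open>layer_prod d Ws i j\<close> is \<open>Ws (j - 1) * \<dots> * Ws i\<close>.\<close>

definition layer_prod :: "(nat \<Rightarrow> nat) \<Rightarrow> (nat \<Rightarrow> real mat) \<Rightarrow> nat \<Rightarrow> nat \<Rightarrow> real mat" where
  "layer_prod d Ws i j = prod_layers (\<lambda>q. Ws (i + q)) (d i) (j - i)"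

lemma layer_chainD: "layer_chain d L Ws \<Longrightarrow> l < L \<Longrightarrow> Ws l \<in> carrier_mat (d (Suc l)) (d l)"
  by (simp add: layer_chain_def)

lemma layer_prod_0: "layer_prod d Ws 0 j = prod_layers Ws (d 0) j"
  by (simp add: layer_prod_def)

lemma layer_prod_self [simp]: "layer_prod d Ws i i = 1\<^sub>m (d i)"
  by (simp add: layer_prod_def)

lemma layer_prod_Suc: "i \<le> j \<Longrightarrow> layer_prod d Ws i (Suc j) = Ws j * layer_prod d Ws i j"
  by (simp add: layer_prod_def Suc_diff_le)

lemma prod_layers_cong: "(\<And>q. q < k \<Longrightarrow> Ws q = Ws' q) \<Longrightarrow> prod_layers Ws n0 k = prod_layers Ws' n0 k"
  by (induction k) auto

lemma layer_prod_cong: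
  assumes "\<And>q. i \<le> q \<Longrightarrow> q < j \<Longrightarrow> Ws q = Ws' q"
  shows "layer_prod d Ws i j = layer_prod d Ws' i j"
  unfolding layer_prod_def using assms by (intro prod_layers_cong) auto

lemma layer_prod_carrier:
  assumes "layer_chain d L Ws" and "i \<le> j" and "j \<le> L"
  shows "layer_prod d Ws i j \<in> carrier_mat (d j) (d i)"
  using assms(2,3)
proof (induction j rule: dec_induct)
  case (step j)
  then show ?case using layer_chainD[OF assms(1), of j] by (simp add: layer_prod_Suc)
qed simp

lemma prod_layers_carrier:
  assumes "layer_chain d L Ws" and "k \<le> L"
  shows "prod_layers Ws (d 0) k \<in> carrier_mat (d k) (d 0)"
  using layer_prod_carrier[OF assms(1), of 0 k] assms(2) by (simp add: layer_prod_0)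

lemma layer_prod_mult:
  assumes chain: "layer_chain d L Ws" and "i \<le> j" and "j \<le> k" and "k \<le> L"
  shows "layer_prod d Ws j k * layer_prod d Ws i j = layer_prod d Ws i k"
  using assms(3,4)
proof (induction k rule: dec_induct)
  case base
  then show ?case using layer_prod_carrier[OF chain \<open>i \<le> j\<close>] by simp
next
  case (step k)
  have "Ws k \<in> carrier_mat (d (Suc k)) (d k)" "layer_prod d Ws j k \<in> carrier_mat (d k) (d j)"
    "layer_prod d Ws i j \<in> carrier_mat (d j) (d i)"
    using step assms(2) layer_chainD[OF chain] layer_prod_carrier[OF chain] by auto
  then show ?case using step \<open>i \<le> j\<close> by (simp add: layer_prod_Suc assoc_mult_mat_dim)
qed

lemma layer_prod_Suc_left:
  assumes chain: "layer_chain d L Ws" and "i < j" and "j \<le> L"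
  shows "layer_prod d Ws i j = layer_prod d Ws (Suc i) j * Ws i"
  using layer_prod_mult[OF chain, of i "Suc i" j] layer_chainD[OF chain, of i] assms(2,3)
  by (simp add: layer_prod_Suc)

lemma prod_layers_update:
  assumes chain: "layer_chain d L Ws" and l: "l < L" and M: "M \<in> carrier_mat (d (Suc l)) (d l)"
  shows "prod_layers (\<lambda>q. if q = l then M else Ws q) (d 0) L
    = layer_prod d Ws (Suc l) L * M * layer_prod d Ws 0 l"
proof -
  let ?Ws = "\<lambda>q. if q = l then M else Ws q"
  have chain': "layer_chain d L ?Ws" using chain M by (simp add: layer_chain_def)
  have "prod_layers ?Ws (d 0) L = layer_prod d ?Ws l L * layer_prod d ?Ws 0 l"
    using layer_prod_mult[OF chain', of 0 l L] l by (simp add: layer_prod_0)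
  also have "layer_prod d ?Ws l L = layer_prod d ?Ws (Suc l) L * M"
    using layer_prod_Suc_left[OF chain' l] by simp
  also have "layer_prod d ?Ws (Suc l) L = layer_prod d Ws (Suc l) L"
    by (intro layer_prod_cong) auto
  also have "layer_prod d ?Ws 0 l = layer_prod d Ws 0 l"
    by (intro layer_prod_cong) auto
  finally show ?thesis .
qed

lemma prod_layers_update_line:
  assumes chain: "layer_chain d L Ws" and l: "l < L" and H: "H \<in> carrier_mat (d (Suc l)) (d l)"
  shows "prod_layers (\<lambda>q. if q = l then Ws l + h \<cdot>\<^sub>m H else Ws q) (d 0) L
    = prod_layers Ws (d 0) L + h \<cdot>\<^sub>m (layer_prod d Ws (Suc l) L * H * layer_prod d Ws 0 l)"
proof -
  let ?R = "layer_prod d Ws (Suc l) L" and ?Q = "layer_prod d Ws 0 l"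
  have R: "?R \<in> carrier_mat (d L) (d (Suc l))" and Q: "?Q \<in> carrier_mat (d l) (d 0)"
    and W: "Ws l \<in> carrier_mat (d (Suc l)) (d l)"
    using layer_prod_carrier[OF chain] layer_chainD[OF chain] l by auto
  have "prod_layers (\<lambda>q. if q = l then Ws l + h \<cdot>\<^sub>m H else Ws q) (d 0) L
      = ?R * (Ws l + h \<cdot>\<^sub>m H) * ?Q"
    using W H by (intro prod_layers_update[OF chain l]) auto
  also have "?R * (Ws l + h \<cdot>\<^sub>m H) = ?R * Ws l + h \<cdot>\<^sub>m (?R * H)"
    using R W H by (simp add: mult_add_distrib_mat[of ?R "d L" "d (Suc l)"]
        mult_smult_distrib[of ?R "d L" "d (Suc l)"])
  also have "\<dots> * ?Q = ?R * Ws l * ?Q + h \<cdot>\<^sub>m (?R * H) * ?Q"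
    using R W H Q by (intro add_mult_distrib_mat[of _ "d L" "d l"]) auto
  also have "h \<cdot>\<^sub>m (?R * H) * ?Q = h \<cdot>\<^sub>m (?R * H * ?Q)"
    using R H Q by (intro mult_smult_assoc_mat[of _ "d L" "d l"]) auto
  also have "?R * Ws l * ?Q = prod_layers (\<lambda>q. if q = l then Ws l else Ws q) (d 0) L"
    by (rule prod_layers_update[OF chain l W, symmetric])
  also have "(\<lambda>q. if q = l then Ws l else Ws q) = Ws" by auto
  finally show ?thesis .
qed

fun prod_layers_deriv :: "(nat \<Rightarrow> real mat) \<Rightarrow> (nat \<Rightarrow> real mat) \<Rightarrow> nat \<Rightarrow> nat \<Rightarrow> real mat" where
  "prod_layers_deriv Ws Ds n0 0 = 0\<^sub>m n0 n0"
| "prod_layers_deriv Ws Ds n0 (Suc k) = Ds k * prod_layers Ws n0 k + Ws k * prod_layers_deriv Ws Ds n0 k"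

lemma has_mat_derivative_prod_layers:
  assumes layers: "\<And>l. l < L \<Longrightarrow> has_mat_derivative (d (Suc l)) (d l) (W l) (Ds l) t T"
    and "t \<in> T" and "k \<le> L"
  shows "has_mat_derivative (d k) (d 0) (\<lambda>s. prod_layers (\<lambda>q. W q s) (d 0) k)
    (prod_layers_deriv (\<lambda>q. W q t) Ds (d 0) k) t T"
  using \<open>k \<le> L\<close>
proof (induction k)
  case 0
  then show ?case using \<open>t \<in> T\<close> by (simp add: has_mat_derivative_const)
next
  case (Suc k)
  then show ?case using has_mat_derivative_mult[OF layers[of k]] by simp
qed

lemma prod_layers_deriv_carrier:
  assumes "layer_chain d L Ws" and "layer_chain d L Ds" and "k \<le> L"
  shows "prod_layers_deriv Ws Ds (d 0) k \<in> carrier_mat (d k) (d 0)"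
  using assms(3)
proof (induction k)
  case (Suc k)
  then show ?case
    using prod_layers_carrier[OF assms(1), of k] layer_chainD[OF assms(1), of k]
      layer_chainD[OF assms(2), of k] by simp
qed simp

lemma scalar_prod_prod_layers_deriv_Suc:
  assumes Ws: "layer_chain d L Ws" and Ds: "layer_chain d L Ds" and "k < L"
    and u: "u \<in> carrier_vec (d (Suc k))" and v: "v \<in> carrier_vec (d 0)"
  shows "u \<bullet> (prod_layers_deriv Ws Ds (d 0) (Suc k) *\<^sub>v v)
    = u \<bullet> (Ds k *\<^sub>v (layer_prod d Ws 0 k *\<^sub>v v))
      + ((Ws k)\<^sup>T *\<^sub>v u) \<bullet> (prod_layers_deriv Ws Ds (d 0) k *\<^sub>v v)"
proof -
  let ?Q = "layer_prod d Ws 0 k" and ?P = "prod_layers_deriv Ws Ds (d 0) k"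
  have W: "Ws k \<in> carrier_mat (d (Suc k)) (d k)" and D: "Ds k \<in> carrier_mat (d (Suc k)) (d k)"
    and Q: "?Q \<in> carrier_mat (d k) (d 0)" and P: "?P \<in> carrier_mat (d k) (d 0)"
    using layer_chainD[OF Ws] layer_chainD[OF Ds] layer_prod_carrier[OF Ws, of 0 k]
      prod_layers_deriv_carrier[OF Ws Ds, of k] \<open>k < L\<close> by auto
  have "prod_layers_deriv Ws Ds (d 0) (Suc k) *\<^sub>v v = Ds k *\<^sub>v (?Q *\<^sub>v v) + Ws k *\<^sub>v (?P *\<^sub>v v)"
    using add_mult_distrib_mat_vec[of "Ds k * ?Q" "d (Suc k)" "d 0" "Ws k * ?P" v] W D Q P v
    by (simp add: layer_prod_0[symmetric] assoc_mult_mat_vec_dim)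
  also have "u \<bullet> \<dots> = u \<bullet> (Ds k *\<^sub>v (?Q *\<^sub>v v)) + u \<bullet> (Ws k *\<^sub>v (?P *\<^sub>v v))"
    using W D Q P u v by (intro scalar_prod_add_distrib[of _ "d (Suc k)"]) auto
  also have "u \<bullet> (Ws k *\<^sub>v (?P *\<^sub>v v)) = ((Ws k)\<^sup>T *\<^sub>v u) \<bullet> (?P *\<^sub>v v)"
    using transpose_vec_mult_scalar[OF W _ u, of "?P *\<^sub>v v"] P v by simp
  finally show ?thesis .
qed

lemma scalar_prod_prod_layers_deriv:
  assumes Ws: "layer_chain d L Ws" and Ds: "layer_chain d L Ds" and v: "v \<in> carrier_vec (d 0)"
    and "k \<le> L" and "u \<in> carrier_vec (d k)"
  shows "u \<bullet> (prod_layers_deriv Ws Ds (d 0) k *\<^sub>v v)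
    = (\<Sum>l<k. u \<bullet> (layer_prod d Ws (Suc l) k *\<^sub>v (Ds l *\<^sub>v (layer_prod d Ws 0 l *\<^sub>v v))))"
  using assms(4,5)
proof (induction k arbitrary: u)
  case 0
  have "0\<^sub>m (d 0) (d 0) *\<^sub>v v = 0\<^sub>v (d 0)" using v by (intro eq_vecI) auto
  then show ?case using 0 by simp
next
  case (Suc k)
  let ?velocity = "\<lambda>l. Ds l *\<^sub>v (layer_prod d Ws 0 l *\<^sub>v v)"
  have k: "k < L" "k \<le> L" using Suc.prems by auto
  note u = \<open>u \<in> carrier_vec (d (Suc k))\<close> and W = layer_chainD[OF Ws k(1)]
  have velocity: "?velocity l \<in> carrier_vec (d (Suc l))" if "l \<le> k" for l
    using layer_prod_carrier[OF Ws, of 0 l] layer_chainD[OF Ds, of l] v that k by simp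
  have "((Ws k)\<^sup>T *\<^sub>v u) \<bullet> (layer_prod d Ws (Suc l) k *\<^sub>v ?velocity l)
      = u \<bullet> (layer_prod d Ws (Suc l) (Suc k) *\<^sub>v ?velocity l)" if "l < k" for l
  proof -
    have R: "layer_prod d Ws (Suc l) k \<in> carrier_mat (d k) (d (Suc l))"
      using layer_prod_carrier[OF Ws _ k(2)] that by simp
    show ?thesis
      using transpose_vec_mult_scalar[OF W _ u, of "layer_prod d Ws (Suc l) k *\<^sub>v ?velocity l"]
        W R velocity[of l] that by (simp add: layer_prod_Suc assoc_mult_mat_vec[of _ _ _ _ "d (Suc l)"])
  qed
  then have "((Ws k)\<^sup>T *\<^sub>v u) \<bullet> (prod_layers_deriv Ws Ds (d 0) k *\<^sub>v v)
      = (\<Sum>l<k. u \<bullet> (layer_prod d Ws (Suc l) (Suc k) *\<^sub>v ?velocity l))"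
    using Suc.IH[OF k(2), of "(Ws k)\<^sup>T *\<^sub>v u"] W u by simp
  then show ?case
    unfolding scalar_prod_prod_layers_deriv_Suc[OF Ws Ds k(1) u v] using velocity[of k] by simp
qed

section \<open>Balanced layers\<close>

lemma mult_pow_mat_mult:
  fixes A B :: "'a :: semiring_1 mat"
  assumes A: "A \<in> carrier_mat n p" and B: "B \<in> carrier_mat p n"
  shows "A * (B * A) ^\<^sub>m i * B = (A * B) ^\<^sub>m Suc i"
proof (induction i)
  case 0
  then show ?case using A B by simp
next
  case (Suc i)
  have BA: "(B * A) ^\<^sub>m i \<in> carrier_mat p p" using A B by simp
  have "A * (B * A) ^\<^sub>m Suc i * B = (A * (B * A) ^\<^sub>m i * B) * (A * B)"
    using A B carrier_matD[OF BA] by (simp add: assoc_mult_mat_dim)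
  also have "\<dots> = (A * B) ^\<^sub>m Suc (Suc i)" unfolding Suc by simp
  finally show ?case .
qed

lemma balanced_layer_prod_gram:
  assumes chain: "layer_chain d L Ws" and bal: "balanced_layers L Ws" and "i \<le> j" and "j < L"
  shows "layer_prod d Ws i (Suc j) * (layer_prod d Ws i (Suc j))\<^sup>T = (Ws j * (Ws j)\<^sup>T) ^\<^sub>m (Suc j - i)"
  using assms(3,4)
proof (induction j rule: dec_induct)
  case base
  then show ?case using layer_chainD[OF chain, of i] by (simp add: layer_prod_Suc)
next
  case (step j)
  let ?W = "Ws (Suc j)" and ?P = "layer_prod d Ws i (Suc j)"
  have W: "?W \<in> carrier_mat (d (Suc (Suc j))) (d (Suc j))"
    and P: "?P \<in> carrier_mat (d (Suc j)) (d i)"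
    using layer_chainD[OF chain] layer_prod_carrier[OF chain] step by auto
  have "layer_prod d Ws i (Suc (Suc j)) * (layer_prod d Ws i (Suc (Suc j)))\<^sup>T = ?W * (?P * ?P\<^sup>T) * ?W\<^sup>T"
    using W P step(1) by (simp add: layer_prod_Suc[of i "Suc j"] transpose_mult_dim assoc_mult_mat_dim)
  also have "?P * ?P\<^sup>T = (?W\<^sup>T * ?W) ^\<^sub>m (Suc j - i)"
    using step bal by (simp add: balanced_layers_def)
  also have "?W * \<dots> * ?W\<^sup>T = (?W * ?W\<^sup>T) ^\<^sub>m (Suc (Suc j) - i)"
    using mult_pow_mat_mult[OF W, of "?W\<^sup>T" "Suc j - i"] W step(1) by (simp add: Suc_diff_le)
  finally show ?case .
qed

lemma balanced_left_singular_vector: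
  assumes chain: "layer_chain d L Ws" and bal: "balanced_layers L Ws" and "0 < L"
    and triple: "singular_triple (d L) (d 0) (prod_layers Ws (d 0) L) \<sigma> u v"
    and \<mu>: "\<mu> \<ge> 0" "\<mu> ^ L = \<sigma>\<^sup>2" and "i \<le> L"
  shows "(layer_prod d Ws i L * (layer_prod d Ws i L)\<^sup>T) *\<^sub>v u = \<mu> ^ (L - i) \<cdot>\<^sub>v u"
proof -
  obtain j where L: "L = Suc j" using \<open>0 < L\<close> by (cases L) auto
  let ?A = "Ws j * (Ws j)\<^sup>T"
  note u = singular_tripleD(2)[OF triple]
  have W: "Ws j \<in> carrier_mat (d L) (d j)" using layer_chainD[OF chain, of j] L by simp
  then have A: "?A \<in> carrier_mat (d L) (d L)" by simp
  have gram: "layer_prod d Ws i L * (layer_prod d Ws i L)\<^sup>T = ?A ^\<^sub>m (L - i)" if "i < L" for i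
    using balanced_layer_prod_gram[OF chain bal, of i j] that L by simp
  have "?A ^\<^sub>m L *\<^sub>v u = \<mu> ^ L \<cdot>\<^sub>v u"
    using singular_triple_gram[OF triple] gram[of 0] \<mu>(2) \<open>0 < L\<close> by (simp add: layer_prod_0)
  then have "?A *\<^sub>v u = \<mu> \<cdot>\<^sub>v u"
    by (rule psd_mat_pow_eigenvector[OF psd_mat_gram[OF W] u \<mu>(1) \<open>0 < L\<close>])
  from pow_mat_eigenvector[OF A u this, of "L - i"] show ?thesis
    using gram[of i] \<open>i \<le> L\<close> u by (cases "i = L") auto
qed

definition transpose_layers :: "nat \<Rightarrow> (nat \<Rightarrow> real mat) \<Rightarrow> nat \<Rightarrow> real mat" where
  "transpose_layers L Ws l = (Ws (L - Suc l))\<^sup>T"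

lemma layer_chain_transpose_layers:
  assumes "layer_chain d L Ws"
  shows "layer_chain (\<lambda>l. d (L - l)) L (transpose_layers L Ws)"
  unfolding layer_chain_def transpose_layers_def
proof (intro allI impI)
  fix l assume "l < L"
  then show "(Ws (L - Suc l))\<^sup>T \<in> carrier_mat (d (L - Suc l)) (d (L - l))"
    using layer_chainD[OF assms, of "L - Suc l"] by (simp add: Suc_diff_Suc)
qed

lemma balanced_transpose_layers:
  assumes "balanced_layers L Ws"
  shows "balanced_layers L (transpose_layers L Ws)"
  unfolding balanced_layers_def transpose_layers_def
proof (intro allI impI)
  fix l assume "Suc l < L"
  then show "((Ws (L - Suc (Suc l)))\<^sup>T)\<^sup>T * (Ws (L - Suc (Suc l)))\<^sup>T
      = (Ws (L - Suc l))\<^sup>T * ((Ws (L - Suc l))\<^sup>T)\<^sup>T"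
    using assms[unfolded balanced_layers_def, rule_format, of "L - Suc (Suc l)"]
    by (simp add: Suc_diff_Suc)
qed

lemma layer_prod_transpose_layers:
  assumes chain: "layer_chain d L Ws" and "i \<le> j" and "j \<le> L"
  shows "layer_prod (\<lambda>l. d (L - l)) (transpose_layers L Ws) i j = (layer_prod d Ws (L - j) (L - i))\<^sup>T"
  using assms(2,3)
proof (induction j rule: dec_induct)
  case (step j)
  have "layer_prod d Ws (L - j) (L - i) \<in> carrier_mat (d (L - i)) (d (L - j))"
    using layer_prod_carrier[OF chain, of "L - j" "L - i"] step by simp
  moreover have "Ws (L - Suc j) \<in> carrier_mat (d (L - j)) (d (L - Suc j))"
    using layer_chainD[OF chain, of "L - Suc j"] step by (simp add: Suc_diff_Suc)
  ultimately show ?case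
    using layer_prod_Suc_left[OF chain, of "L - Suc j" "L - i"] step
    by (simp add: layer_prod_Suc transpose_layers_def transpose_mult_dim Suc_diff_Suc)
qed simp

lemma balanced_right_singular_vector:
  assumes chain: "layer_chain d L Ws" and bal: "balanced_layers L Ws" and "0 < L"
    and triple: "singular_triple (d L) (d 0) (prod_layers Ws (d 0) L) \<sigma> u v"
    and \<mu>: "\<mu> \<ge> 0" "\<mu> ^ L = \<sigma>\<^sup>2" and "j \<le> L"
  shows "((layer_prod d Ws 0 j)\<^sup>T * layer_prod d Ws 0 j) *\<^sub>v v = \<mu> ^ j \<cdot>\<^sub>v v"
proof -
  have "prod_layers (transpose_layers L Ws) (d L) L = (prod_layers Ws (d 0) L)\<^sup>T"
    using layer_prod_transpose_layers[OF chain, of 0 L] by (simp add: layer_prod_0)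
  then show ?thesis
    using balanced_left_singular_vector[OF layer_chain_transpose_layers[OF chain]
        balanced_transpose_layers[OF bal] \<open>0 < L\<close>, of \<sigma> v u \<mu> "L - j"]
      singular_triple_transpose[OF triple] \<mu> \<open>j \<le> L\<close> layer_prod_transpose_layers[OF chain, of "L - j" L]
    by simp
qed

section \<open>Gradient flow on the factors\<close>

definition layer_pullback :: "(nat \<Rightarrow> nat) \<Rightarrow> nat \<Rightarrow> (nat \<Rightarrow> real mat) \<Rightarrow> real mat \<Rightarrow> nat \<Rightarrow> real mat" where
  "layer_pullback d L Ws G l = (layer_prod d Ws (Suc l) L)\<^sup>T * G * (layer_prod d Ws 0 l)\<^sup>T"

lemma layer_pullback_carrier:
  assumes "layer_chain d L Ws" and "G \<in> carrier_mat (d L) (d 0)" and "l < L"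
  shows "layer_pullback d L Ws G l \<in> carrier_mat (d (Suc l)) (d l)"
  using layer_prod_carrier[OF assms(1), of "Suc l" L] layer_prod_carrier[OF assms(1), of 0 l] assms(2,3)
  by (simp add: layer_pullback_def)

lemma layer_pullback_uminus:
  assumes "layer_chain d L Ws" and "G \<in> carrier_mat (d L) (d 0)" and "l < L"
  shows "layer_pullback d L Ws (- G) l = - layer_pullback d L Ws G l"
  using layer_prod_carrier[OF assms(1), of "Suc l" L] layer_prod_carrier[OF assms(1), of 0 l] assms(2,3)
  by (simp add: layer_pullback_def)

lemma grad_mat_prod_layers:
  assumes chain: "layer_chain d L Ws" and l: "l < L" and G: "G \<in> carrier_mat (d L) (d 0)"
    and f: "\<And>H. H \<in> carrier_mat (d L) (d 0) \<Longrightarrow>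
      ((\<lambda>h. f (prod_layers Ws (d 0) L + h \<cdot>\<^sub>m H)) has_real_derivative frob_inner G H) (at 0)"
  shows "grad_mat (\<lambda>M. f (prod_layers (\<lambda>q. if q = l then M else Ws q) (d 0) L)) (Ws l)
    = layer_pullback d L Ws G l"
proof (rule grad_mat_eqI)
  let ?R = "layer_prod d Ws (Suc l) L" and ?Q = "layer_prod d Ws 0 l"
  have R: "?R \<in> carrier_mat (d L) (d (Suc l))" and Q: "?Q \<in> carrier_mat (d l) (d 0)"
    using layer_prod_carrier[OF chain] l by auto
  show "Ws l \<in> carrier_mat (d (Suc l)) (d l)" by (rule layer_chainD[OF chain l])
  show "layer_pullback d L Ws G l \<in> carrier_mat (d (Suc l)) (d l)"
    by (rule layer_pullback_carrier[OF chain G l])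
  fix H :: "real mat" assume H: "H \<in> carrier_mat (d (Suc l)) (d l)"
  have RHQ: "?R * H * ?Q \<in> carrier_mat (d L) (d 0)" using R H Q by auto
  have "frob_inner G (?R * H * ?Q) = frob_inner (G * ?Q\<^sup>T) (?R * H)"
    using R H Q G by (intro frob_inner_mult_right) auto
  also have "\<dots> = frob_inner (?R\<^sup>T * (G * ?Q\<^sup>T)) H"
    using R H Q G by (intro frob_inner_mult_left) auto
  also have "?R\<^sup>T * (G * ?Q\<^sup>T) = layer_pullback d L Ws G l"
    using R Q G by (simp add: layer_pullback_def assoc_mult_mat_dim)
  finally show "((\<lambda>h. f (prod_layers (\<lambda>q. if q = l then Ws l + h \<cdot>\<^sub>m H else Ws q) (d 0) L))
      has_real_derivative frob_inner (layer_pullback d L Ws G l) H) (at 0)"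
    using f[OF RHQ] by (simp add: prod_layers_update_line[OF chain l H])
qed

lemma layer_pullback_balance:
  assumes chain: "layer_chain d L Ws" and G: "G \<in> carrier_mat (d L) (d 0)" and l: "Suc l < L"
  shows "(Ws (Suc l))\<^sup>T * layer_pullback d L Ws G (Suc l) = layer_pullback d L Ws G l * (Ws l)\<^sup>T"
proof -
  let ?R = "layer_prod d Ws (Suc (Suc l)) L" and ?Q = "layer_prod d Ws 0 l"
  have "?R \<in> carrier_mat (d L) (d (Suc (Suc l)))" "?Q \<in> carrier_mat (d l) (d 0)"
    "Ws l \<in> carrier_mat (d (Suc l)) (d l)" "Ws (Suc l) \<in> carrier_mat (d (Suc (Suc l))) (d (Suc l))"
    using layer_prod_carrier[OF chain] layer_chainD[OF chain] l by auto
  moreover have "layer_prod d Ws (Suc l) L = ?R * Ws (Suc l)"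
    using layer_prod_Suc_left[OF chain l] by simp
  ultimately show ?thesis
    using G by (simp add: layer_pullback_def layer_prod_Suc transpose_mult_dim assoc_mult_mat_dim)
qed

lemma balanced_layers_conserved:
  assumes flow: "\<And>l s. l < L \<Longrightarrow> s \<in> T \<Longrightarrow>
      has_mat_derivative (d (Suc l)) (d l) (W l) (layer_pullback d L (\<lambda>q. W q s) (F s) l) s T"
    and F: "\<And>s. s \<in> T \<Longrightarrow> F s \<in> carrier_mat (d L) (d 0)"
    and "convex T" and "t\<^sub>0 \<in> T" and "balanced_layers L (\<lambda>q. W q t\<^sub>0)" and "t \<in> T"
  shows "balanced_layers L (\<lambda>q. W q t)"
  unfolding balanced_layers_def
proof (intro allI impI)
  fix l assume l: "Suc l < L"
  show "(W (Suc l) t)\<^sup>T * W (Suc l) t = W l t * (W l t)\<^sup>T"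
  proof (rule gram_balance_conserved[OF flow flow])
    fix s assume s: "s \<in> T"
    have "layer_chain d L (\<lambda>q. W q s)"
      using has_mat_derivativeD(2)[OF flow s] s by (simp add: layer_chain_def)
    then show "(W (Suc l) s)\<^sup>T * layer_pullback d L (\<lambda>q. W q s) (F s) (Suc l)
        = layer_pullback d L (\<lambda>q. W q s) (F s) l * (W l s)\<^sup>T"
      using layer_pullback_balance[OF _ F[OF s] l] by blast
  qed (use assms(3-6) l in \<open>auto simp: balanced_layers_def\<close>)
qed

lemma layer_pullback_bilinear:
  assumes chain: "layer_chain d L Ws" and l: "l < L" and F: "F \<in> carrier_mat (d L) (d 0)"
    and u: "u \<in> carrier_vec (d L)" and v: "v \<in> carrier_vec (d 0)"
  shows "u \<bullet> (layer_prod d Ws (Suc l) L *\<^sub>v (layer_pullback d L Ws F l *\<^sub>v (layer_prod d Ws 0 l *\<^sub>v v)))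
    = ((layer_prod d Ws (Suc l) L * (layer_prod d Ws (Suc l) L)\<^sup>T) *\<^sub>v u)
      \<bullet> (F *\<^sub>v (((layer_prod d Ws 0 l)\<^sup>T * layer_prod d Ws 0 l) *\<^sub>v v))"
proof -
  let ?R = "layer_prod d Ws (Suc l) L" and ?Q = "layer_prod d Ws 0 l"
  have R: "?R \<in> carrier_mat (d L) (d (Suc l))" and Q: "?Q \<in> carrier_mat (d l) (d 0)"
    using layer_prod_carrier[OF chain] l by auto
  have "?R *\<^sub>v (layer_pullback d L Ws F l *\<^sub>v (?Q *\<^sub>v v)) = (?R * ?R\<^sup>T) *\<^sub>v (F *\<^sub>v ((?Q\<^sup>T * ?Q) *\<^sub>v v))"
    using R Q F v by (simp add: layer_pullback_def assoc_mult_mat_vec_dim)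
  moreover have "F *\<^sub>v ((?Q\<^sup>T * ?Q) *\<^sub>v v) \<in> carrier_vec (d L)"
    using Q F v by (auto intro!: mult_mat_vec_carrier)
  moreover have "(?R * ?R\<^sup>T)\<^sup>T = ?R * ?R\<^sup>T"
    using R by (simp add: transpose_mult_dim)
  ultimately show ?thesis
    using symmetric_scalar_prod[of "?R * ?R\<^sup>T" "d L" u "F *\<^sub>v ((?Q\<^sup>T * ?Q) *\<^sub>v v)"] R u by simp
qed

lemma balanced_flow_bilinear:
  assumes chain: "layer_chain d L Ws" and bal: "balanced_layers L Ws" and F: "F \<in> carrier_mat (d L) (d 0)"
    and triple: "singular_triple (d L) (d 0) (prod_layers Ws (d 0) L) \<sigma> u v"
    and \<mu>: "\<mu> \<ge> 0" "\<mu> ^ L = \<sigma>\<^sup>2"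
  shows "u \<bullet> (prod_layers_deriv Ws (layer_pullback d L Ws F) (d 0) L *\<^sub>v v)
    = real L * \<mu> ^ (L - 1) * (u \<bullet> (F *\<^sub>v v))"
proof -
  note u = singular_tripleD(2)[OF triple] and v = singular_tripleD(3)[OF triple]
  have layer: "u \<bullet> (layer_prod d Ws (Suc l) L *\<^sub>v (layer_pullback d L Ws F l *\<^sub>v (layer_prod d Ws 0 l *\<^sub>v v)))
      = \<mu> ^ (L - 1) * (u \<bullet> (F *\<^sub>v v))" if l: "l < L" for l
  proof -
    have "0 < L" using l by simp
    have "u \<bullet> (layer_prod d Ws (Suc l) L *\<^sub>v (layer_pullback d L Ws F l *\<^sub>v (layer_prod d Ws 0 l *\<^sub>v v)))
        = (\<mu> ^ (L - Suc l) \<cdot>\<^sub>v u) \<bullet> (F *\<^sub>v (\<mu> ^ l \<cdot>\<^sub>v v))"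
      unfolding layer_pullback_bilinear[OF chain l F u v]
      using balanced_left_singular_vector[OF chain bal \<open>0 < L\<close> triple \<mu>, of "Suc l"]
        balanced_right_singular_vector[OF chain bal \<open>0 < L\<close> triple \<mu>, of l] l by simp
    also have "\<dots> = \<mu> ^ (L - Suc l) * \<mu> ^ l * (u \<bullet> (F *\<^sub>v v))"
      using mult_mat_vec[OF F v] F u v by simp
    also have "\<mu> ^ (L - Suc l) * \<mu> ^ l = \<mu> ^ (L - 1)"
      using l by (simp add: power_add[symmetric])
    finally show ?thesis .
  qed
  have "layer_chain d L (layer_pullback d L Ws F)"
    using layer_pullback_carrier[OF chain F] by (simp add: layer_chain_def)
  from scalar_prod_prod_layers_deriv[OF chain this v order_refl u] show ?thesis
    by (simp add: layer)
qed

lemma power_powr_inverse: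
  fixes x :: real
  assumes "N > 0"
  shows "(x powr (1 / real L)) ^ N = x powr (real N / real L)"
  using powr_realpow'[of "x powr (1 / real L)" N] assms by (simp add: powr_powr)

lemma balanced_flow_singular_value:
  assumes L: "L \<ge> 2" and flow: "\<And>l s. l < L \<Longrightarrow> s \<in> T \<Longrightarrow>
      has_mat_derivative (d (Suc l)) (d l) (W l) (layer_pullback d L (\<lambda>q. W q s) (F s) l) s T"
    and F: "\<And>s. s \<in> T \<Longrightarrow> F s \<in> carrier_mat (d L) (d 0)"
    and "convex T" and "t\<^sub>0 \<in> T" and "balanced_layers L (\<lambda>q. W q t\<^sub>0)"
    and svd: "\<And>s. s \<in> T \<Longrightarrow> is_svd (d L) (d 0) (prod_layers (\<lambda>q. W q s) (d 0) L) (U s) (S s) (V s)"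
    and U: "has_mat_derivative (d L) (d L) U U' t T" and V: "has_mat_derivative (d 0) (d 0) V V' t T"
    and limpt: "t islimpt T" and k: "k < min (d L) (d 0)"
  shows "((\<lambda>s. S s $$ (k,k)) has_real_derivative
      real L * ((S t $$ (k,k))\<^sup>2) powr (1 - 1 / real L) * (col (U t) k \<bullet> (F t *\<^sub>v col (V t) k)))
    (at t within T)"
proof -
  define \<mu> where "\<mu> = ((S t $$ (k,k))\<^sup>2) powr (1 / real L)"
  have \<mu>: "\<mu> \<ge> 0" "\<mu> ^ L = (S t $$ (k,k))\<^sup>2"
    using L power_powr_inverse[of L] by (auto simp: \<mu>_def)
  have \<mu>_power: "\<mu> ^ (L - 1) = ((S t $$ (k,k))\<^sup>2) powr (1 - 1 / real L)"
    using L power_powr_inverse[of "L - 1" _ L] by (simp add: \<mu>_def of_nat_diff diff_divide_distrib)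
  have t: "t \<in> T" using U by (rule has_mat_derivativeD(1))
  have chain: "layer_chain d L (\<lambda>q. W q t)"
    using has_mat_derivativeD(2)[OF flow t] t by (simp add: layer_chain_def)
  have bal: "balanced_layers L (\<lambda>q. W q t)"
    by (rule balanced_layers_conserved[OF flow F]) (use assms(4-6) t in auto)
  have X: "has_mat_derivative (d L) (d 0) (\<lambda>s. prod_layers (\<lambda>q. W q s) (d 0) L)
      (prod_layers_deriv (\<lambda>q. W q t) (layer_pullback d L (\<lambda>q. W q t) (F t)) (d 0) L) t T"
    using flow t by (intro has_mat_derivative_prod_layers[where L = L]) auto
  show ?thesis
    using singular_value_derivative[OF U V X svd limpt k]
    unfolding balanced_flow_bilinear[OF chain bal F[OF t] is_svd_singular_triple[OF svd[OF t] k] \<mu>]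
      \<mu>_power .
qed

section \<open>The regularised loss\<close>

definition reg_loss_grad ::
    "(real mat \<Rightarrow> real) \<Rightarrow> real \<Rightarrow> real \<Rightarrow> real mat \<Rightarrow> real mat \<Rightarrow> real mat \<Rightarrow> real mat" where
  "reg_loss_grad LY lr lc Lr Lc X = grad_mat LY X + (2 * lr) \<cdot>\<^sub>m (Lr * X) + (2 * lc) \<cdot>\<^sub>m (X * Lc)"

lemma reg_loss_grad_carrier:
  assumes "X \<in> carrier_mat m n" and "Lr \<in> carrier_mat m m" and "Lc \<in> carrier_mat n n"
  shows "reg_loss_grad LY lr lc Lr Lc X \<in> carrier_mat m n"
  using assms grad_mat_carrier[OF assms(1)] by (simp add: reg_loss_grad_def)

lemma reg_loss_directional_derivative:
  assumes LY: "analytic_mat_fun m n LY" and X: "X \<in> carrier_mat m n" and H: "H \<in> carrier_mat m n"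
    and Lr: "Lr \<in> carrier_mat m m" "Lr\<^sup>T = Lr" and Lc: "Lc \<in> carrier_mat n n" "Lc\<^sup>T = Lc"
  shows "((\<lambda>h. reg_loss LY lr lc Lr Lc (X + h \<cdot>\<^sub>m H)) has_real_derivative
    frob_inner (reg_loss_grad LY lr lc Lr Lc X) H) (at 0)"
proof -
  have carriers: "grad_mat LY X \<in> carrier_mat m n" "Lr * X \<in> carrier_mat m n" "X * Lc \<in> carrier_mat m n"
    using X Lr Lc grad_mat_carrier by auto
  have row_term: "((\<lambda>h. mat_trace ((X + h \<cdot>\<^sub>m H)\<^sup>T * Lr * (X + h \<cdot>\<^sub>m H)))
      has_real_derivative 2 * frob_inner (Lr * X) H) (at 0)"
    by (rule mat_trace_quadratic_directional_derivative[OF X H Lr])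
  have transpose_line: "(X + h \<cdot>\<^sub>m H)\<^sup>T = X\<^sup>T + h \<cdot>\<^sub>m H\<^sup>T" for h
    using X H by (intro eq_matI) auto
  have "((\<lambda>h. mat_trace ((X\<^sup>T + h \<cdot>\<^sub>m H\<^sup>T)\<^sup>T * Lc * (X\<^sup>T + h \<cdot>\<^sub>m H\<^sup>T)))
      has_real_derivative 2 * frob_inner (Lc * X\<^sup>T) H\<^sup>T) (at 0)"
    using X H Lc by (intro mat_trace_quadratic_directional_derivative) auto
  moreover have "frob_inner (Lc * X\<^sup>T) H\<^sup>T = frob_inner (X * Lc) H"
    using frob_inner_transpose[OF carriers(3) H] X Lc by (simp add: transpose_mult_dim)
  ultimately have col_term: "((\<lambda>h. mat_trace ((X + h \<cdot>\<^sub>m H) * Lc * (X + h \<cdot>\<^sub>m H)\<^sup>T))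
      has_real_derivative 2 * frob_inner (X * Lc) H) (at 0)"
    by (simp add: transpose_line[symmetric])
  have "frob_inner (reg_loss_grad LY lr lc Lr Lc X) H = frob_inner (grad_mat LY X) H
      + lr * (2 * frob_inner (Lr * X) H) + lc * (2 * frob_inner (X * Lc) H)"
    using carriers by (simp add: reg_loss_grad_def frob_inner_add_left[of _ m n] frob_inner_smult_left)
  then show ?thesis unfolding reg_loss_def
    by (simp only:) (intro DERIV_add DERIV_cmult row_term col_term
        analytic_mat_fun_directional_derivative[OF LY X H])
qed

lemma grad_mat_reg_loss_prod_layers:
  assumes chain: "layer_chain d L Ws" and "l < L" and LY: "analytic_mat_fun (d L) (d 0) LY"
    and "psd_mat (d L) Lr" and "psd_mat (d 0) Lc"
  shows "grad_mat (\<lambda>M. reg_loss LY lr lc Lr Lc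
      (prod_layers (\<lambda>q. if q = l then M else Ws q) (d 0) L)) (Ws l)
    = layer_pullback d L Ws (reg_loss_grad LY lr lc Lr Lc (prod_layers Ws (d 0) L)) l"
proof (rule grad_mat_prod_layers[OF chain \<open>l < L\<close>])
  have X: "prod_layers Ws (d 0) L \<in> carrier_mat (d L) (d 0)"
    by (rule prod_layers_carrier[OF chain order_refl])
  then show "reg_loss_grad LY lr lc Lr Lc (prod_layers Ws (d 0) L) \<in> carrier_mat (d L) (d 0)"
    using assms(4,5) by (intro reg_loss_grad_carrier) (auto simp: psd_mat_def)
  fix H :: "real mat" assume "H \<in> carrier_mat (d L) (d 0)"
  then show "((\<lambda>h. reg_loss LY lr lc Lr Lc (prod_layers Ws (d 0) L + h \<cdot>\<^sub>m H)) has_real_derivative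
      frob_inner (reg_loss_grad LY lr lc Lr Lc (prod_layers Ws (d 0) L)) H) (at 0)"
    using assms(4,5) by (intro reg_loss_directional_derivative[OF LY X]) (auto simp: psd_mat_def)
qed

lemma reg_loss_grad_singular_triple:
  assumes triple: "singular_triple m n X \<sigma> u v"
    and Lr: "Lr \<in> carrier_mat m m" and Lc: "Lc \<in> carrier_mat n n"
  shows "u \<bullet> (reg_loss_grad LY lr lc Lr Lc X *\<^sub>v v) = frob_inner (grad_mat LY X) (outer_prod u v)
    + 2 * \<sigma> * (lr * (u \<bullet> (Lr *\<^sub>v u)) + lc * (v \<bullet> (Lc *\<^sub>v v)))"
proof -
  note X = singular_tripleD(1)[OF triple] and u = singular_tripleD(2)[OF triple]
    and v = singular_tripleD(3)[OF triple] and Xv = singular_tripleD(4)[OF triple]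
    and Xu = singular_tripleD(5)[OF triple]
  let ?G = "grad_mat LY X" and ?R = "(2 * lr) \<cdot>\<^sub>m (Lr * X)" and ?C = "(2 * lc) \<cdot>\<^sub>m (X * Lc)"
  have carriers: "?G \<in> carrier_mat m n" "?R \<in> carrier_mat m n" "?C \<in> carrier_mat m n"
    using grad_mat_carrier[OF X] X Lr Lc by auto
  have "(?G + ?R + ?C) *\<^sub>v v = ?G *\<^sub>v v + ?R *\<^sub>v v + ?C *\<^sub>v v"
    using add_mult_distrib_mat_vec[of "?G + ?R" m n ?C v] add_mult_distrib_mat_vec[of ?G m n ?R v]
      carriers v by simp
  then have "u \<bullet> (reg_loss_grad LY lr lc Lr Lc X *\<^sub>v v) = u \<bullet> (?G *\<^sub>v v) + u \<bullet> (?R *\<^sub>v v) + u \<bullet> (?C *\<^sub>v v)"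
    unfolding reg_loss_grad_def
    using scalar_prod_add_distrib[of u m "?G *\<^sub>v v + ?R *\<^sub>v v" "?C *\<^sub>v v"]
      scalar_prod_add_distrib[of u m "?G *\<^sub>v v" "?R *\<^sub>v v"] carriers u v by simp
  also have "u \<bullet> (?G *\<^sub>v v) = frob_inner ?G (outer_prod u v)"
    by (rule frob_inner_outer_prod[OF carriers(1) u v, symmetric])
  also have "u \<bullet> (?R *\<^sub>v v) = 2 * lr * \<sigma> * (u \<bullet> (Lr *\<^sub>v u))"
    using X Lr u v Xv mult_mat_vec[OF Lr u] by (simp add: smult_mult_mat_vec assoc_mult_mat_vec_dim)
  also have "u \<bullet> (?C *\<^sub>v v) = 2 * lc * (u \<bullet> (X *\<^sub>v (Lc *\<^sub>v v)))"
    using X Lc u v by (simp add: smult_mult_mat_vec assoc_mult_mat_vec_dim)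
  also have "u \<bullet> (X *\<^sub>v (Lc *\<^sub>v v)) = (X\<^sup>T *\<^sub>v u) \<bullet> (Lc *\<^sub>v v)"
    using transpose_vec_mult_scalar[OF X _ u, of "Lc *\<^sub>v v"] Lc v by simp
  also have "\<dots> = \<sigma> * (v \<bullet> (Lc *\<^sub>v v))"
    using Xu Lc v by simp
  finally show ?thesis by (simp add: algebra_simps)
qed

lemma regularised_flow_has_mat_derivative:
  assumes LY: "analytic_mat_fun (d L) (d 0) LY" and Lr: "psd_mat (d L) Lr" and Lc: "psd_mat (d 0) Lc"
    and chain: "\<And>s. s \<in> T \<Longrightarrow> layer_chain d L (\<lambda>q. W q s)" and l: "l < L" and s: "s \<in> T"
    and flow: "\<And>i j. i < d (Suc l) \<Longrightarrow> j < d l \<Longrightarrow> ((\<lambda>\<tau>. W l \<tau> $$ (i,j)) has_real_derivative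
      - (grad_mat (\<lambda>M. reg_loss LY lr lc Lr Lc
          (prod_layers (\<lambda>q. if q = l then M else W q s) (d 0) L)) (W l s)) $$ (i,j)) (at s within T)"
  shows "has_mat_derivative (d (Suc l)) (d l) (W l) (layer_pullback d L (\<lambda>q. W q s)
    (- reg_loss_grad LY lr lc Lr Lc (prod_layers (\<lambda>q. W q s) (d 0) L)) l) s T"
proof -
  define G where "G = reg_loss_grad LY lr lc Lr Lc (prod_layers (\<lambda>q. W q s) (d 0) L)"
  have G: "G \<in> carrier_mat (d L) (d 0)"
    unfolding G_def using prod_layers_carrier[OF chain[OF s] order_refl] Lr Lc
    by (intro reg_loss_grad_carrier) (auto simp: psd_mat_def)
  have pullback: "layer_pullback d L (\<lambda>q. W q s) G l \<in> carrier_mat (d (Suc l)) (d l)"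
    by (rule layer_pullback_carrier[OF chain[OF s] G l])
  show ?thesis
    unfolding G_def[symmetric] layer_pullback_uminus[OF chain[OF s] G l]
    using s pullback layer_chainD[OF chain l]
      flow[unfolded grad_mat_reg_loss_prod_layers[OF chain[OF s] l LY Lr Lc] G_def[symmetric]]
    by (intro has_mat_derivativeI[where f = "\<lambda>i j \<tau>. W l \<tau> $$ (i,j)"]) auto
qed

lemma regularised_flow_singular_value:
  assumes L: "L \<ge> 2"
    and LY: "analytic_mat_fun (d L) (d 0) LY" and Lr: "psd_mat (d L) Lr" and Lc: "psd_mat (d 0) Lc"
    and chain: "\<And>s. s \<in> T \<Longrightarrow> layer_chain d L (\<lambda>q. W q s)"
    and flow: "\<And>l s i j. l < L \<Longrightarrow> s \<in> T \<Longrightarrow> i < d (Suc l) \<Longrightarrow> j < d l \<Longrightarrow>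
      ((\<lambda>\<tau>. W l \<tau> $$ (i,j)) has_real_derivative
        - (grad_mat (\<lambda>M. reg_loss LY lr lc Lr Lc
            (prod_layers (\<lambda>q. if q = l then M else W q s) (d 0) L)) (W l s)) $$ (i,j)) (at s within T)"
    and T: "convex T" "t\<^sub>0 \<in> T" "t islimpt T" and bal: "balanced_layers L (\<lambda>q. W q t\<^sub>0)"
    and svd: "\<And>s. s \<in> T \<Longrightarrow> is_svd (d L) (d 0) (prod_layers (\<lambda>q. W q s) (d 0) L) (U s) (S s) (V s)"
    and U: "has_mat_derivative (d L) (d L) U U' t T" and V: "has_mat_derivative (d 0) (d 0) V V' t T"
    and k: "k < min (d L) (d 0)"
    and \<sigma>: "\<sigma> = S t $$ (k,k)" and u: "u = col (U t) k" and v: "v = col (V t) k"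
  shows "((\<lambda>s. S s $$ (k,k)) has_real_derivative
      - real L * (\<sigma>\<^sup>2) powr (1 - 1 / real L)
        * frob_inner (grad_mat LY (prod_layers (\<lambda>q. W q t) (d 0) L)) (outer_prod u v)
      - 2 * real L * (\<sigma>\<^sup>2) powr (3 / 2 - 1 / real L)
        * (lr * (u \<bullet> (Lr *\<^sub>v u)) + lc * (v \<bullet> (Lc *\<^sub>v v)))) (at t within T)"
proof -
  let ?X = "\<lambda>s. prod_layers (\<lambda>q. W q s) (d 0) L"
  define G where "G s = reg_loss_grad LY lr lc Lr Lc (?X s)" for s
  have carriers: "Lr \<in> carrier_mat (d L) (d L)" "Lc \<in> carrier_mat (d 0) (d 0)"
    using Lr Lc by (auto simp: psd_mat_def)
  have X: "?X s \<in> carrier_mat (d L) (d 0)" if "s \<in> T" for s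
    using prod_layers_carrier[OF chain[OF that]] by simp
  then have G: "- G s \<in> carrier_mat (d L) (d 0)" if "s \<in> T" for s
    using reg_loss_grad_carrier[OF X[OF that] carriers] by (simp add: G_def)
  have t: "t \<in> T" using U by (rule has_mat_derivativeD(1))
  have triple: "singular_triple (d L) (d 0) (?X t) \<sigma> u v"
    unfolding \<sigma> u v by (rule is_svd_singular_triple[OF svd[OF t] k])
  have "((\<lambda>s. S s $$ (k,k)) has_real_derivative
      real L * (\<sigma>\<^sup>2) powr (1 - 1 / real L) * (u \<bullet> (- G t *\<^sub>v v))) (at t within T)"
    unfolding \<sigma> u v
  proof (rule balanced_flow_singular_value[OF L _ G T(1,2) bal svd U V T(3) k])
    fix l s assume "l < L" "s \<in> T"
    then show "has_mat_derivative (d (Suc l)) (d l) (W l) (layer_pullback d L (\<lambda>q. W q s) (- G s) l) s T"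
      unfolding G_def using flow by (intro regularised_flow_has_mat_derivative[OF LY Lr Lc chain])
  qed
  also have "u \<bullet> (- G t *\<^sub>v v) = - (u \<bullet> (G t *\<^sub>v v))"
    using G[OF t] singular_tripleD(2,3)[OF triple] by auto
  also have "u \<bullet> (G t *\<^sub>v v) = frob_inner (grad_mat LY (?X t)) (outer_prod u v)
      + 2 * \<sigma> * (lr * (u \<bullet> (Lr *\<^sub>v u)) + lc * (v \<bullet> (Lc *\<^sub>v v)))" (is "_ = ?g + 2 * \<sigma> * ?\<gamma>")
    unfolding G_def by (rule reg_loss_grad_singular_triple[OF triple carriers])
  also have "real L * (\<sigma>\<^sup>2) powr (1 - 1 / real L) * - (?g + 2 * \<sigma> * ?\<gamma>)
      = - real L * (\<sigma>\<^sup>2) powr (1 - 1 / real L) * ?g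
        - 2 * real L * ((\<sigma>\<^sup>2) powr (1 - 1 / real L) * \<sigma>) * ?\<gamma>"
    by (simp add: algebra_simps)
  also have "(\<sigma>\<^sup>2) powr (1 - 1 / real L) * \<sigma> = (\<sigma>\<^sup>2) powr (3 / 2 - 1 / real L)"
    using powr_add[of "\<sigma>\<^sup>2" "1 - 1 / real L" "1 / 2"] svd[OF t] k by (auto simp: is_svd_def \<sigma>)
  finally show ?thesis .
qed

theorem theorem1:
  fixes m n L :: nat and d :: "nat \<Rightarrow> nat"
    and W :: "nat \<Rightarrow> real \<Rightarrow> real mat"
    and LY :: "real mat \<Rightarrow> real" and lr lc :: real
    and Wr Wc :: "real mat"
    and U S V :: "real \<Rightarrow> real mat"
    and k :: nat and t :: real
  assumes mn: "m \<ge> 1" "n \<ge> 1" and L2: "L \<ge> 2"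
    and d0: "d 0 = n" and dL: "d L = m" and dpos: "\<And>l. 0 < l \<Longrightarrow> l < L \<Longrightarrow> d l \<ge> 1"
    and Wdim: "\<And>l s. l < L \<Longrightarrow> s \<ge> 0 \<Longrightarrow> W l s \<in> carrier_mat (d (Suc l)) (d l)"
    and balanced: "\<And>l. l + 2 \<le> L \<Longrightarrow>
        transpose_mat (W (Suc l) 0) * W (Suc l) 0 = W l 0 * transpose_mat (W l 0)"
    and LY_analytic: "analytic_mat_fun m n LY"
    and lam: "lr \<ge> 0" "lc \<ge> 0"
    and Wr: "Wr \<in> carrier_mat m m" and Wc: "Wc \<in> carrier_mat n n"
    and flow: "\<And>l s i j. l < L \<Longrightarrow> s \<ge> 0 \<Longrightarrow> i < d (Suc l) \<Longrightarrow> j < d l \<Longrightarrow>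
        ((\<lambda>\<tau>. W l \<tau> $$ (i,j)) has_real_derivative
           - (grad_mat (\<lambda>M. reg_loss LY lr lc (adaptive_laplacian m Wr) (adaptive_laplacian n Wc)
                    (prod_layers (\<lambda>q. if q = l then M else W q s) n L)) (W l s)) $$ (i,j))
         (at s within {0..})"
    and U_dim: "\<And>s. s \<ge> 0 \<Longrightarrow> U s \<in> carrier_mat m m"
    and S_dim: "\<And>s. s \<ge> 0 \<Longrightarrow> S s \<in> carrier_mat m n"
    and V_dim: "\<And>s. s \<ge> 0 \<Longrightarrow> V s \<in> carrier_mat n n"
    and U_orth: "\<And>s. s \<ge> 0 \<Longrightarrow> transpose_mat (U s) * U s = 1\<^sub>m m"
    and V_orth: "\<And>s. s \<ge> 0 \<Longrightarrow> transpose_mat (V s) * V s = 1\<^sub>m n"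
    and S_diag: "\<And>s i j. s \<ge> 0 \<Longrightarrow> i < m \<Longrightarrow> j < n \<Longrightarrow> i \<noteq> j \<Longrightarrow> S s $$ (i,j) = 0"
    and S_nonneg: "\<And>s i. s \<ge> 0 \<Longrightarrow> i < min m n \<Longrightarrow> S s $$ (i,i) \<ge> 0"
    and svd: "\<And>s. s \<ge> 0 \<Longrightarrow> prod_layers (\<lambda>q. W q s) n L = U s * S s * transpose_mat (V s)"
    and U_an: "\<And>i j. i < m \<Longrightarrow> j < m \<Longrightarrow> analytic_on_nonneg (\<lambda>s. U s $$ (i,j))"
    and S_an: "\<And>i j. i < m \<Longrightarrow> j < n \<Longrightarrow> analytic_on_nonneg (\<lambda>s. S s $$ (i,j))"
    and V_an: "\<And>i j. i < n \<Longrightarrow> j < n \<Longrightarrow> analytic_on_nonneg (\<lambda>s. V s $$ (i,j))"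
    and k: "k < min m n" and t: "t \<ge> 0"
  shows
    "let Lr = adaptive_laplacian m Wr; Lc = adaptive_laplacian n Wc;
         \<sigma> = S t $$ (k,k); u = col (U t) k; v = col (V t) k;
         X = prod_layers (\<lambda>q. W q t) n L;
         \<gamma> = lr * (u \<bullet> (Lr *\<^sub>v u)) + lc * (v \<bullet> (Lc *\<^sub>v v))
     in ((\<lambda>s. S s $$ (k,k)) has_real_derivative
           (- real L * (\<sigma>\<^sup>2) powr (1 - 1 / real L) * frob_inner (grad_mat LY X) (outer_prod u v)
            - 2 * real L * (\<sigma>\<^sup>2) powr (3 / 2 - 1 / real L) * \<gamma>))
          (at t within {0..})
        \<and> \<gamma> \<ge> 0"
proof -
  have chain: "layer_chain d L (\<lambda>q. W q s)" if "s \<in> {0..}" for s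
    using Wdim that by (simp add: layer_chain_def)
  have bal: "balanced_layers L (\<lambda>q. W q 0)"
    using balanced by (simp add: balanced_layers_def)
  have svd': "is_svd m n (prod_layers (\<lambda>q. W q s) n L) (U s) (S s) (V s)" if "s \<in> {0..}" for s
    using that by (intro is_svdI U_dim S_dim V_dim U_orth V_orth S_diag S_nonneg svd) auto
  obtain U' where U': "has_mat_derivative m m U U' t {0..}"
    using has_mat_derivative_if_analytic[OF U_dim U_an t] .
  obtain V' where V': "has_mat_derivative n n V V' t {0..}"
    using has_mat_derivative_if_analytic[OF V_dim V_an t] .
  show ?thesis
    unfolding Let_def
  proof (intro conjI, goal_cases)
    case 1
    show ?case
      by (rule regularised_flow_singular_value[where d = d and L = L and W = W and T = "{0..}" and t\<^sub>0 = 0,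
          unfolded d0 dL, OF L2 LY_analytic psd_mat_adaptive_laplacian psd_mat_adaptive_laplacian chain
          _ _ _ islimpt_atLeast[OF t] bal svd' U' V' k refl refl refl]) (use flow in auto)
  next
    case 2
    show ?case
      by (intro add_nonneg_nonneg mult_nonneg_nonneg psd_mat_nonneg[OF psd_mat_adaptive_laplacian] lam)
        (use U_dim[OF t] V_dim[OF t] in \<open>auto simp: carrier_vecI\<close>)
  qed
qed

end
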